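(* Let $K$ be a field of characteristic $0$, let $H=H(x,y)=\log(\exp(x)\exp(y))\in K\{\{x,y\}\}$ be the non-associative Hausdorff series, and write $H=\sum_{n=1}^{\infty}H_n$ with $H_n$ homogeneous of degree $n$. Then every homogeneous component $H_n$ is a primitive element for the co-addition, i.e. $\Delta(H_n)=H_n\otimes 1+1\otimes H_n$ for all $n\geq 1$.
   Context: For a set $X$, $M(X)$ is the free magma (without unit) on $X$; its elements are parenthesized words, i.e. planar binary rooted trees with leaves labeled by $X$; $\deg$ is the number of leaves. $K\{X\}$ is the free unital, not necessarily associative or commutative, $K$-algebra on $X$, with $K$-basis $M(X)\cup\{1\}$, graded by $\deg$. $K\{\{X\}\}=\prod_n K\{X\}_n$ is its completion (power series in non-associative variables). The co-addition is the unital algebra homomorphism $\Delta:K\{X\}\to K\{X\}\otimes K\{X\}$ with $\Delta(x_i)=x_i\otimes 1+1\otimes x_i$ for all $x_i\in X$ (the tensor product carries the component-wise multiplication). $\exp(x)\in K\{\{x\}\}$ is the unique power series in one non-associative variable with constant term $1$ satisfying $\exp(x)\exp(x)=\exp(2x)$ and $\exp'(x)=\exp(x)$, where $'$ is the continuous derivation $\frac{d}{dx}$ with $\frac{d}{dx}x=1$. $\log(1+x)$ is the inverse of $\exp(x)-1$ with respect to composition of series. $H(x,y)=\log(\exp(x)\exp(y))$ is the unique series without constant term in the two non-associative variables $x,y$ with $\exp(H)=\exp(x)\exp(y)$. *)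

theory Defs
  imports "HOL-Library.Groups_Big_Fun"
begin

section \<open>Unital magmas\<close>

text \<open>No associativity is assumed. Finiteness of the set of factorizations of each element
  makes the convolution product of arbitrary (formal) series well defined.\<close>

class unital_magma = times + one +
  assumes magma_one_left [simp]: "1 * a = a"
    and magma_one_right [simp]: "a * 1 = a"
    and finite_factorizations: "finite {(a, b). a * b = c}"

text \<open>\<open>'x mag\<close> is the free magma $M(X)$ and \<open>'x umag\<close> is $M(X) \cup \{1\}$, where $X$ is the type
  \<open>'x\<close>.\<close>

datatype 'x mag = Leaf 'x | Node "'x mag" "'x mag"

datatype 'x umag = Empty | Word "'x mag"

primrec leaves :: "'x mag \<Rightarrow> nat" where
  "leaves (Leaf x) = 1"
| "leaves (Node u v) = leaves u + leaves v"

primrec deg :: "'x umag \<Rightarrow> nat" where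
  "deg Empty = 0"
| "deg (Word u) = leaves u"

instantiation umag :: (type) unital_magma
begin

definition one_umag :: "'x umag" where
  "one_umag = Empty"

fun times_umag :: "'x umag \<Rightarrow> 'x umag \<Rightarrow> 'x umag" where
  "times_umag Empty v = v"
| "times_umag (Word u) Empty = Word u"
| "times_umag (Word u) (Word v) = Word (Node u v)"

instance
proof
  fix a c :: "'x umag"
  show "1 * a = a" by (simp add: one_umag_def)
  show "a * 1 = a" by (cases a) (simp_all add: one_umag_def)
  have "{(a, b). a * b = c} \<subseteq> {(Empty, c), (c, Empty)} \<union>
      (case c of Word (Node u v) \<Rightarrow> {(Word u, Word v)} | _ \<Rightarrow> {})"
  proof
    fix p :: "'x umag \<times> 'x umag" assume "p \<in> {(a, b). a * b = c}"
    then obtain a b where "p = (a, b)" "c = a * b" by auto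
    then show "p \<in> {(Empty, c), (c, Empty)} \<union>
        (case c of Word (Node u v) \<Rightarrow> {(Word u, Word v)} | _ \<Rightarrow> {})"
      by (cases a; cases b) auto
  qed
  moreover have "finite (case c of Word (Node u v) \<Rightarrow> {(Word u, Word v)} | _ \<Rightarrow> {})"
    by (auto split: umag.split mag.split)
  ultimately show "finite {(a, b). a * b = c}"
    by (meson finite.emptyI finite.insertI finite_UnI finite_subset)
qed

end

instantiation prod :: (unital_magma, unital_magma) unital_magma
begin

definition one_prod :: "'a \<times> 'b" where
  "one_prod = (1, 1)"

definition times_prod :: "'a \<times> 'b \<Rightarrow> 'a \<times> 'b \<Rightarrow> 'a \<times> 'b" where
  "times_prod p q = (fst p * fst q, snd p * snd q)"

instance
proof
  fix p c :: "'a \<times> 'b"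
  show "1 * p = p" "p * 1 = p" by (simp_all add: one_prod_def times_prod_def)
  have "{(p, q). p * q = c} \<subseteq> (\<lambda>((a, a'), (b, b')). ((a, b), (a', b'))) `
      ({(a, a'). a * a' = fst c} \<times> {(b, b'). b * b' = snd c})"
    by (force simp: times_prod_def)
  then show "finite {(p, q). p * q = c}"
    by (rule finite_subset) (intro finite_imageI finite_cartesian_product finite_factorizations)
qed

end

text \<open>The value of a word under the magma homomorphism extending an assignment of the letters.\<close>

primrec mag_eval :: "('x \<Rightarrow> 'a::times) \<Rightarrow> 'x mag \<Rightarrow> 'a" where
  "mag_eval g (Leaf x) = g x"
| "mag_eval g (Node u v) = mag_eval g u * mag_eval g v"

primrec umag_eval :: "('x \<Rightarrow> 'a::{times, one}) \<Rightarrow> 'x umag \<Rightarrow> 'a" where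
  "umag_eval g Empty = 1"
| "umag_eval g (Word u) = mag_eval g u"


section \<open>Magma algebras, the free algebra $K\{X\}$ and its tensor square\<close>

text \<open>\<open>('m, 'k) malg\<close> is the $K$-algebra with basis the unital magma \<open>'m\<close>.  Hence
  \<open>('x umag, 'k) malg\<close> is $K\{X\}$.\<close>

typedef (overloaded) ('m, 'k) malg = "{f :: 'm \<Rightarrow> 'k::zero. finite {m. f m \<noteq> 0}}"
  morphisms pcoeff Abs_malg
  by (rule exI [of _ "\<lambda>_. 0"]) simp

setup_lifting type_definition_malg

instantiation malg :: (type, ab_group_add) ab_group_add
begin

lift_definition zero_malg :: "('a, 'b) malg" is "\<lambda>_. 0" by simp

lift_definition plus_malg :: "('a, 'b) malg \<Rightarrow> ('a, 'b) malg \<Rightarrow> ('a, 'b) malg"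
  is "\<lambda>f g m. f m + g m"
  subgoal for f g
    by (rule finite_subset [of _ "{m. f m \<noteq> 0} \<union> {m. g m \<noteq> 0}"]) auto
  done

lift_definition minus_malg :: "('a, 'b) malg \<Rightarrow> ('a, 'b) malg \<Rightarrow> ('a, 'b) malg"
  is "\<lambda>f g m. f m - g m"
  subgoal for f g
    by (rule finite_subset [of _ "{m. f m \<noteq> 0} \<union> {m. g m \<noteq> 0}"]) auto
  done

lift_definition uminus_malg :: "('a, 'b) malg \<Rightarrow> ('a, 'b) malg" is "\<lambda>f m. - f m" by simp

instance
  by standard (transfer; simp add: fun_eq_iff algebra_simps)+

end

lift_definition malg_smul :: "'k \<Rightarrow> ('m, 'k) malg \<Rightarrow> ('m, 'k::mult_zero) malg"
  is "\<lambda>c f m. c * f m"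
  by (erule rev_finite_subset) auto

lift_definition malg_mono :: "'m \<Rightarrow> ('m, 'k::zero_neq_one) malg"
  is "\<lambda>m m'. if m' = m then 1 else 0"
  by simp

instantiation malg :: (unital_magma, comm_ring_1) "{times, one}"
begin

definition one_malg :: "('a, 'b) malg" where
  "one_malg = malg_mono 1"

lift_definition times_malg :: "('a, 'b) malg \<Rightarrow> ('a, 'b) malg \<Rightarrow> ('a, 'b) malg"
  is "\<lambda>f g c. \<Sum>(a, b) \<in> {(a, b). a * b = c}. f a * g b"
  subgoal for f g
  proof (rule finite_subset)
    show "{c. (\<Sum>(a, b) \<in> {(a, b). a * b = c}. f a * g b) \<noteq> 0} \<subseteq>
        (\<lambda>(a, b). a * b) ` ({a. f a \<noteq> 0} \<times> {b. g b \<noteq> 0})"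
    proof clarify
      fix c assume "(\<Sum>(a, b) \<in> {(a, b). a * b = c}. f a * g b) \<noteq> 0"
      then obtain p where "p \<in> {(a, b). a * b = c}" "(case p of (a, b) \<Rightarrow> f a * g b) \<noteq> 0"
        by (rule sum.not_neutral_contains_not_neutral)
      then obtain a b where "a * b = c" "f a * g b \<noteq> 0" by auto
      then show "c \<in> (\<lambda>(a, b). a * b) ` ({a. f a \<noteq> 0} \<times> {b. g b \<noteq> 0})"
        by (intro image_eqI [of _ _ "(a, b)"]) (auto intro: ccontr)
    qed
  qed auto
  done

instance ..

end

definition malg_var :: "'x \<Rightarrow> ('x umag, 'k::zero_neq_one) malg" where
  "malg_var x = malg_mono (Word (Leaf x))"

text \<open>Since \<open>('m, 'k) malg\<close> is free over $K$ with basis \<open>'m\<close>, the tensor product of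
  \<open>('m, 'k) malg\<close> and \<open>('n, 'k) malg\<close> is free with basis the pairs, i.e. it is
  \<open>('m \<times> 'n, 'k) malg\<close>; the component-wise product of tensors is the product of the magma algebra
  of \<open>'m \<times> 'n\<close> (lemma \<open>tensor_mult_tensor\<close> below).\<close>

lift_definition tensor ::
  "('m, 'k) malg \<Rightarrow> ('n, 'k) malg \<Rightarrow> ('m \<times> 'n, 'k::mult_zero) malg"  (infixl "\<otimes>" 75)
  is "\<lambda>f g (a, b). f a * g b"
  subgoal for f g
    by (rule finite_subset [of _ "{a. f a \<noteq> 0} \<times> {b. g b \<noteq> 0}"]) auto
  done

text \<open>The co-addition: on words it is forced by multiplicativity, and it is extended linearly.
  It is the unique unital algebra homomorphism with the prescribed values on the variables (theorems
  \<open>unital_hom_coaddition\<close>, \<open>coaddition_var\<close>, \<open>coaddition_unique\<close>).\<close>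

definition coaddition :: "('x umag, 'k::comm_ring_1) malg \<Rightarrow> ('x umag \<times> 'x umag, 'k) malg" where
  "coaddition p = (\<Sum>m | pcoeff p m \<noteq> 0.
     malg_smul (pcoeff p m) (umag_eval (\<lambda>x. malg_var x \<otimes> 1 + 1 \<otimes> malg_var x) m))"


section \<open>Non-associative power series\<close>

text \<open>All functions \<open>'m \<Rightarrow> 'k\<close>.  For finite $X$ each degree has only finitely many words, so
  \<open>('x umag, 'k) series\<close> is the completion $K\{\{X\}\} = \prod_n K\{X\}_n$; only the cases of one and
  of two variables are used.\<close>

typedef ('m, 'k) series = "UNIV :: ('m \<Rightarrow> 'k) set"
  morphisms scoeff Abs_series ..

setup_lifting type_definition_series

instantiation series :: (type, ab_group_add) ab_group_add
begin

lift_definition zero_series :: "('a, 'b) series" is "\<lambda>_. 0" .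
lift_definition plus_series :: "('a, 'b) series \<Rightarrow> ('a, 'b) series \<Rightarrow> ('a, 'b) series"
  is "\<lambda>f g m. f m + g m" .
lift_definition minus_series :: "('a, 'b) series \<Rightarrow> ('a, 'b) series \<Rightarrow> ('a, 'b) series"
  is "\<lambda>f g m. f m - g m" .
lift_definition uminus_series :: "('a, 'b) series \<Rightarrow> ('a, 'b) series" is "\<lambda>f m. - f m" .

instance
  by standard (transfer; simp add: fun_eq_iff algebra_simps)+

end

lift_definition series_smul :: "'k \<Rightarrow> ('m, 'k) series \<Rightarrow> ('m, 'k::times) series"
  is "\<lambda>c f m. c * f m" .

lift_definition series_mono :: "'m \<Rightarrow> ('m, 'k::zero_neq_one) series"
  is "\<lambda>m m'. if m' = m then 1 else 0" .

instantiation series :: (unital_magma, comm_ring_1) "{times, one}"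
begin

definition one_series :: "('a, 'b) series" where
  "one_series = series_mono 1"

lift_definition times_series :: "('a, 'b) series \<Rightarrow> ('a, 'b) series \<Rightarrow> ('a, 'b) series"
  is "\<lambda>f g c. \<Sum>(a, b) \<in> {(a, b). a * b = c}. f a * g b" .

instance ..

end

definition series_var :: "'x \<Rightarrow> ('x umag, 'k::zero_neq_one) series" where
  "series_var x = series_mono (Word (Leaf x))"

text \<open>The continuous linear extension $f \mapsto \sum_m f_m \varphi(m)$ of a map on words.  The
  convention that \<^const>\<open>Sum_any\<close> is \<open>0\<close> for infinite support is never used below: in each coefficient
  only finitely many words contribute (lemmas \<open>subst_support\<close> and \<open>deriv_support\<close>).\<close>

definition lin_ext ::
  "('m \<Rightarrow> ('n, 'k) series) \<Rightarrow> ('m, 'k::comm_ring_1) series \<Rightarrow> ('n, 'k) series" where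
  "lin_ext \<phi> f = Abs_series (\<lambda>w. Sum_any (\<lambda>m. scoeff f m * scoeff (\<phi> m) w))"

text \<open>Composition $f(g)$ of a series in one variable (the variable being \<open>()\<close>) with a series \<open>g\<close>
  without constant term.\<close>

definition series_comp ::
  "(unit umag, 'k) series \<Rightarrow> ('x umag, 'k::comm_ring_1) series \<Rightarrow> ('x umag, 'k) series" where
  "series_comp f g = lin_ext (umag_eval (\<lambda>_. g)) f"

abbreviation ivar :: "(unit umag, 'k::zero_neq_one) series" where
  "ivar \<equiv> series_var ()"

text \<open>The continuous derivation with value \<open>1\<close> on the variable (theorems \<open>series_deriv_mult\<close>,
  \<open>series_deriv_ivar\<close>).\<close>

primrec mag_deriv :: "unit mag \<Rightarrow> (unit umag, 'k::comm_ring_1) series" where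
  "mag_deriv (Leaf _) = 1"
| "mag_deriv (Node u v) =
     mag_deriv u * series_mono (Word v) + series_mono (Word u) * mag_deriv v"

primrec umag_deriv :: "unit umag \<Rightarrow> (unit umag, 'k::comm_ring_1) series" where
  "umag_deriv Empty = 0"
| "umag_deriv (Word u) = mag_deriv u"

definition series_deriv ::
  "(unit umag, 'k::comm_ring_1) series \<Rightarrow> (unit umag, 'k) series" where
  "series_deriv f = lin_ext umag_deriv f"


section \<open>Exponential, logarithm and Hausdorff series\<close>

text \<open>The descriptions below are proper: theorems \<open>ex1_nexp\<close> and \<open>ex1_nlog1p\<close>.\<close>

definition is_nexp :: "(unit umag, 'k::field_char_0) series \<Rightarrow> bool" where
  "is_nexp e \<longleftrightarrow> scoeff e 1 = 1 \<and> e * e = series_comp e (series_smul 2 ivar) \<and> series_deriv e = e"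

definition nexp :: "(unit umag, 'k::field_char_0) series" where
  "nexp = (THE e. is_nexp e)"

text \<open>The series $\log(1+x)$.\<close>

definition is_nlog1p :: "(unit umag, 'k::field_char_0) series \<Rightarrow> bool" where
  "is_nlog1p l \<longleftrightarrow> scoeff l 1 = 0 \<and> series_comp l (nexp - 1) = ivar \<and> series_comp (nexp - 1) l = ivar"

definition nlog1p :: "(unit umag, 'k::field_char_0) series" where
  "nlog1p = (THE l. is_nlog1p l)"

text \<open>The logarithm $\log(f)$ of a series \<open>f\<close> with constant term \<open>1\<close>.\<close>

definition nlog :: "('x umag, 'k::field_char_0) series \<Rightarrow> ('x umag, 'k) series" where
  "nlog f = series_comp nlog1p (f - 1)"

datatype xy = Var_x | Var_y

instance xy :: finite
proof
  have "(UNIV :: xy set) \<subseteq> {Var_x, Var_y}" using xy.exhaust by auto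
  then show "finite (UNIV :: xy set)" by (rule finite_subset) simp
qed

text \<open>Equivalently, the unique series without constant term satisfying
  $\exp(H) = \exp(x)\exp(y)$ (theorem \<open>hausdorff_iff\<close>).\<close>

definition hausdorff :: "(xy umag, 'k::field_char_0) series" where
  "hausdorff = nlog (series_comp nexp (series_var Var_x) * series_comp nexp (series_var Var_y))"

lemma leaves_pos: "0 < leaves u"
  by (induction u) auto

lemma finite_leaves: "finite {u :: 'x::finite mag. leaves u \<le> n}"
proof (induction n)
  case 0
  have "{u :: 'x mag. leaves u \<le> 0} = {}" using leaves_pos by (auto simp: not_le)
  then show ?case by (metis finite.emptyI)
next
  case (Suc n)
  have "{u :: 'x mag. leaves u \<le> Suc n} \<subseteq> range Leaf \<union>
      (\<lambda>(u, v). Node u v) ` ({u. leaves u \<le> n} \<times> {u. leaves u \<le> n})"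
  proof
    fix u :: "'x mag" assume "u \<in> {u. leaves u \<le> Suc n}"
    then show "u \<in> range Leaf \<union> (\<lambda>(u, v). Node u v) ` ({u. leaves u \<le> n} \<times> {u. leaves u \<le> n})"
    proof (cases u)
      case (Node a b)
      then have "leaves a \<le> n" "leaves b \<le> n"
        using \<open>u \<in> _\<close> leaves_pos [of a] leaves_pos [of b] by auto
      then show ?thesis using Node by auto
    qed auto
  qed
  then show ?case
    by (rule finite_subset) (intro finite_UnI finite_imageI finite_cartesian_product Suc; simp)
qed

lemma finite_deg: "finite {w :: 'x::finite umag. deg w \<le> n}"
proof (rule finite_subset)
  show "{w :: 'x umag. deg w \<le> n} \<subseteq> insert Empty (Word ` {u. leaves u \<le> n})"
  proof
    fix w :: "'x umag" assume "w \<in> {w. deg w \<le> n}"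
    then show "w \<in> insert Empty (Word ` {u. leaves u \<le> n})" by (cases w) auto
  qed
qed (simp add: finite_leaves)

text \<open>The homogeneous component of degree \<open>n\<close>, as an element of $K\{X\}$.\<close>

lift_definition hom_component ::
  "nat \<Rightarrow> ('x::finite umag, 'k::zero) series \<Rightarrow> ('x umag, 'k) malg"
  is "\<lambda>n f w. if deg w = n then f w else 0"
  by (rule finite_subset [OF _ finite_deg]) (auto split: if_splits)

section \<open>Well-definedness\<close>

subsection \<open>The co-addition is the homomorphism determined by its values on the variables\<close>

lemma pcoeff_simps [simp]:
  "pcoeff 0 m = (0 :: 'k::ab_group_add)"
  "pcoeff (f + g) m = pcoeff f m + (pcoeff g m :: 'k)"
  "pcoeff (malg_smul c p) m = c * (pcoeff p m :: 'l::mult_zero)"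
  "pcoeff (malg_mono w) m = (if m = w then 1 else 0 :: 'h::zero_neq_one)"
  "pcoeff (p \<otimes> q) (u, v) = pcoeff p u * (pcoeff q v :: 'l)"
  by (transfer; simp)+

lemma pcoeff_sum: "pcoeff (sum f A) m = (\<Sum>i\<in>A. pcoeff (f i) m :: 'k::ab_group_add)"
  by (induction A rule: infinite_finite_induct) auto

lemma pcoeff_mult:
  "pcoeff (f * g) c = (\<Sum>(a, b) \<in> {(a, b). a * b = c}. pcoeff f a * pcoeff g b)"
  by transfer simp

lemma finite_pcoeff: "finite {m. pcoeff p m \<noteq> 0}"
  by transfer

lemma malg_eqI: "(\<And>m. pcoeff f m = pcoeff g m) \<Longrightarrow> f = g"
  by transfer auto

lemma pcoeff_mult_sum:
  assumes A: "finite A" "{m. pcoeff f m \<noteq> 0} \<subseteq> A" and B: "finite B" "{m. pcoeff g m \<noteq> 0} \<subseteq> B"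
  shows "pcoeff (f * g) c = (\<Sum>a\<in>A. \<Sum>b\<in>B. if a * b = c then pcoeff f a * pcoeff g b else 0)"
proof -
  have "pcoeff (f * g) c =
      (\<Sum>(a, b) \<in> {(a, b). a * b = c} \<inter> A \<times> B. pcoeff f a * pcoeff g b)"
    unfolding pcoeff_mult
    by (rule sum.mono_neutral_right) (use A B in \<open>auto intro: finite_factorizations\<close>)
  also have "\<dots> = (\<Sum>(a, b) \<in> A \<times> B. if a * b = c then pcoeff f a * pcoeff g b else 0)"
    by (rule sum.mono_neutral_cong_left) (use A B in \<open>auto split: if_splits\<close>)
  finally show ?thesis by (simp add: sum.cartesian_product)
qed

lemma malg_mult_add_left: "(f + g) * h = f * h + g * (h :: ('m::unital_magma, 'k::comm_ring_1) malg)"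
  by (rule malg_eqI) (simp add: pcoeff_mult sum.distrib [symmetric] case_prod_unfold algebra_simps)

lemma malg_mult_add_right: "h * (f + g) = h * f + h * (g :: ('m::unital_magma, 'k::comm_ring_1) malg)"
  by (rule malg_eqI) (simp add: pcoeff_mult sum.distrib [symmetric] case_prod_unfold algebra_simps)

lemma malg_mult_smul: "malg_smul c f * g = malg_smul c (f * g)" "f * malg_smul c g = malg_smul c (f * g)"
  by (rule malg_eqI; simp add: pcoeff_mult sum_distrib_left case_prod_unfold algebra_simps)+

lemma malg_mult_zero [simp]:
  "0 * f = (0 :: ('m::unital_magma, 'k::comm_ring_1) malg)" "f * 0 = (0 :: ('m, 'k) malg)"
  by (rule malg_eqI; simp add: pcoeff_mult)+

lemma malg_mult_sum:
  "sum f A * sum g B = (\<Sum>a\<in>A. \<Sum>b\<in>B. f a * g b :: ('m::unital_magma, 'k::comm_ring_1) malg)"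
proof -
  have "h * sum g B = (\<Sum>b\<in>B. h * g b)" for h :: "('m, 'k) malg"
    by (induction B rule: infinite_finite_induct) (auto simp: malg_mult_add_right)
  then show ?thesis
    by (induction A rule: infinite_finite_induct) (auto simp: malg_mult_add_left sum.distrib)
qed

lemma malg_mono_mult: "malg_mono u * malg_mono v = (malg_mono (u * v) :: ('m::unital_magma, 'k::comm_ring_1) malg)"
proof (rule malg_eqI)
  fix c
  show "pcoeff (malg_mono u * malg_mono v) c = (pcoeff (malg_mono (u * v)) c :: 'k)"
    by (subst pcoeff_mult_sum [of "{u}" _ "{v}"]) auto
qed

lemma malg_one_mult [simp]:
  "1 * f = (f :: ('m::unital_magma, 'k::comm_ring_1) malg)" "f * 1 = f"
proof -
  show "1 * f = f"
  proof (rule malg_eqI)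
    fix c
    show "pcoeff (1 * f) c = pcoeff f c"
      unfolding one_malg_def
      by (subst pcoeff_mult_sum [of "{1}" _ "insert c {m. pcoeff f m \<noteq> 0}"])
        (auto simp: finite_pcoeff)
  qed
  show "f * 1 = f"
  proof (rule malg_eqI)
    fix c
    show "pcoeff (f * 1) c = pcoeff f c"
      unfolding one_malg_def
      by (subst pcoeff_mult_sum [of "insert c {m. pcoeff f m \<noteq> 0}" _ "{1}"])
        (auto simp: finite_pcoeff if_distrib cong: if_cong)
  qed
qed

lemma malg_smul_simps:
  "malg_smul c (f + g) = malg_smul c f + malg_smul c (g :: ('m, 'k::comm_ring_1) malg)"
  "malg_smul (c + d) f = malg_smul c f + malg_smul d f"
  "malg_smul c (malg_smul d f) = malg_smul (c * d) f"
  "malg_smul 0 f = 0" "malg_smul 1 f = f"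
  by (rule malg_eqI; simp add: algebra_simps)+

lemma malg_smul_sum: "malg_smul c (sum f A) = (\<Sum>a\<in>A. malg_smul c (f a :: ('m, 'k::comm_ring_1) malg))"
  by (rule malg_eqI) (simp add: pcoeff_sum sum_distrib_left)

lemma tensor_mult_tensor:
  fixes p p' :: "('m::unital_magma, 'k::comm_ring_1) malg" and q q' :: "('n::unital_magma, 'k) malg"
  shows "(p \<otimes> q) * (p' \<otimes> q') = (p * p') \<otimes> (q * q')"
proof (rule malg_eqI)
  fix w :: "'m \<times> 'n"
  obtain u v where w: "w = (u, v)" by (cases w)
  have "pcoeff ((p \<otimes> q) * (p' \<otimes> q')) w =
     (\<Sum>z \<in> {(a, a'). a * a' = u} \<times> {(b, b'). b * b' = v}.
        (pcoeff p (fst (fst z)) * pcoeff p' (snd (fst z))) *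
        (pcoeff q (fst (snd z)) * pcoeff q' (snd (snd z))))"
    unfolding pcoeff_mult w
    by (rule sum.reindex_bij_witness
        [of _ "\<lambda>z. ((fst (fst z), fst (snd z)), (snd (fst z), snd (snd z)))"
            "\<lambda>z. ((fst (fst z), fst (snd z)), (snd (fst z), snd (snd z)))"])
      (auto simp: times_prod_def algebra_simps)
  also have "\<dots> = pcoeff ((p * p') \<otimes> (q * q')) w"
    by (simp add: w pcoeff_mult sum_product sum.cartesian_product case_prod_unfold)
  finally show "pcoeff ((p \<otimes> q) * (p' \<otimes> q')) w = pcoeff ((p * p') \<otimes> (q * q')) w" .
qed

lemma umag_eval_mult:
  assumes "\<And>a :: 'a::{times, one}. 1 * a = a" "\<And>a :: 'a. a * 1 = a"
  shows "umag_eval g (u * v) = umag_eval g u * (umag_eval g v :: 'a)"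
  using assms by (cases u; cases v) auto

definition unital_hom :: "(('m::unital_magma, 'k::comm_ring_1) malg \<Rightarrow> ('n::unital_magma, 'k) malg) \<Rightarrow> bool"
  where "unital_hom \<phi> \<longleftrightarrow> (\<forall>p q. \<phi> (p + q) = \<phi> p + \<phi> q) \<and> (\<forall>c p. \<phi> (malg_smul c p) = malg_smul c (\<phi> p)) \<and>
    \<phi> 1 = 1 \<and> (\<forall>p q. \<phi> (p * q) = \<phi> p * \<phi> q)"

lemma coaddition_superset:
  assumes "finite A" "{m. pcoeff p m \<noteq> 0} \<subseteq> A"
  shows "coaddition p = (\<Sum>m\<in>A. malg_smul (pcoeff p m)
      (umag_eval (\<lambda>x. malg_var x \<otimes> 1 + 1 \<otimes> malg_var x) m))"
  unfolding coaddition_def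
  by (rule sum.mono_neutral_left) (use assms in \<open>auto simp: malg_smul_simps\<close>)

lemma malg_expand:
  assumes "finite A" "{m. pcoeff p m \<noteq> 0} \<subseteq> A"
  shows "p = (\<Sum>m\<in>A. malg_smul (pcoeff p m) (malg_mono m :: ('m, 'k::comm_ring_1) malg))"
  by (rule malg_eqI)
    (use assms in \<open>auto simp: pcoeff_sum if_distrib sum.delta' cong: if_cong\<close>)

lemma coaddition_mono:
  "coaddition (malg_mono m) = umag_eval (\<lambda>x. malg_var x \<otimes> 1 + 1 \<otimes> malg_var x) m"
  by (subst coaddition_superset [of "{m}"]) (auto simp: malg_smul_simps)

lemma coaddition_linear:
  "coaddition (p + q) = coaddition p + coaddition q"
  "coaddition (malg_smul c p) = malg_smul c (coaddition p)"
proof -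
  let ?A = "{m. pcoeff p m \<noteq> 0} \<union> {m. pcoeff q m \<noteq> 0}"
  have "finite ?A" by (simp add: finite_pcoeff)
  then show "coaddition (p + q) = coaddition p + coaddition q"
    by (subst (1 2 3) coaddition_superset [of ?A]) (auto simp: malg_smul_simps sum.distrib)
  show "coaddition (malg_smul c p) = malg_smul c (coaddition p)"
    by (subst (1 2) coaddition_superset [of "{m. pcoeff p m \<noteq> 0}"])
      (auto simp: malg_smul_simps malg_smul_sum finite_pcoeff)
qed

lemma coaddition_sum: "coaddition (sum f A) = (\<Sum>a\<in>A. coaddition (f a))"
proof -
  have "coaddition 0 = 0" by (simp add: coaddition_def)
  then show ?thesis
    by (induction A rule: infinite_finite_induct) (auto simp: coaddition_linear)
qed

theorem unital_hom_coaddition: "unital_hom coaddition"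
  unfolding unital_hom_def
proof (intro conjI allI)
  show "coaddition 1 = 1"
    by (simp add: one_malg_def coaddition_mono)
      (simp add: one_umag_def one_malg_def)
  fix p q :: "('x umag, 'k::comm_ring_1) malg"
  let ?A = "{m. pcoeff p m \<noteq> 0}" and ?B = "{m. pcoeff q m \<noteq> 0}"
  note p = malg_expand [OF finite_pcoeff order_refl, of p]
  note q = malg_expand [OF finite_pcoeff order_refl, of q]
  have "coaddition (p * q) = (\<Sum>a\<in>?A. \<Sum>b\<in>?B. malg_smul (pcoeff p a) (malg_smul (pcoeff q b)
      (coaddition (malg_mono (a * b)))))"
    by (subst p, subst q)
      (simp add: malg_mult_sum coaddition_sum malg_mult_smul malg_mono_mult coaddition_linear
        malg_smul_simps mult.commute)
  also have "\<dots> = coaddition p * coaddition q"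
    by (simp add: coaddition_def [of p] coaddition_def [of q] malg_mult_sum malg_mult_smul
      malg_smul_simps coaddition_mono umag_eval_mult mult.commute)
  finally show "coaddition (p * q) = coaddition p * coaddition q" .
qed (simp_all add: coaddition_linear)

theorem coaddition_var: "coaddition (malg_var x) = malg_var x \<otimes> 1 + 1 \<otimes> malg_var x"
  unfolding malg_var_def [of x] coaddition_mono by (simp add: malg_var_def)

theorem coaddition_unique:
  assumes "unital_hom \<phi>" and "\<And>x. \<phi> (malg_var x) = malg_var x \<otimes> 1 + 1 \<otimes> malg_var x"
  shows "\<phi> = coaddition"
proof
  fix p
  have 0: "\<phi> 0 = 0" using assms(1) unfolding unital_hom_def
    by (metis add_cancel_left_left)
  have sum: "\<phi> (sum f A) = (\<Sum>a\<in>A. \<phi> (f a))" for f and A :: "'c set"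
    using assms(1) 0 unfolding unital_hom_def
    by (induction A rule: infinite_finite_induct) auto
  have "\<phi> (malg_mono (Word u)) = mag_eval (\<lambda>x. malg_var x \<otimes> 1 + 1 \<otimes> malg_var x) u" for u
  proof (induction u)
    case (Leaf x)
    then show ?case using assms(2) by (simp add: malg_var_def)
  next
    case (Node u v)
    have "malg_mono (Word (Node u v)) = malg_mono (Word u) * (malg_mono (Word v) :: ('a umag, 'b) malg)"
      by (simp add: malg_mono_mult)
    then show ?case using Node assms(1) unfolding unital_hom_def by simp
  qed
  moreover have "\<phi> (malg_mono Empty) = 1"
    using assms(1) by (simp add: unital_hom_def one_malg_def one_umag_def)
  ultimately have mono: "\<phi> (malg_mono m) = coaddition (malg_mono m)" for m
    by (cases m) (simp_all add: coaddition_mono)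
  note p = malg_expand [OF finite_pcoeff order_refl, of p]
  show "\<phi> p = coaddition p"
    by (subst (1 2) p) (use assms(1) in \<open>simp add: sum coaddition_sum coaddition_linear mono unital_hom_def\<close>)
qed

subsection \<open>Series\<close>

lemma scoeff_simps [simp]:
  "scoeff 0 m = (0 :: 'k::ab_group_add)"
  "scoeff (f + g) m = scoeff f m + (scoeff g m :: 'k)"
  "scoeff (f - g) m = scoeff f m - (scoeff g m :: 'k)"
  "scoeff (- f) m = - (scoeff f m :: 'k)"
  "scoeff (series_smul c p) m = c * (scoeff p m :: 'l::times)"
  "scoeff (series_mono w) m = (if m = w then 1 else 0 :: 'h::zero_neq_one)"
  by (transfer; simp)+

lemma scoeff_mult:
  "scoeff (f * g) c = (\<Sum>(a, b) \<in> {(a, b). a * b = c}. scoeff f a * scoeff g b)"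
  by transfer simp

lemma series_eqI: "(\<And>m. scoeff f m = scoeff g m) \<Longrightarrow> f = g"
  by transfer auto

lemma scoeff_one: "scoeff 1 m = (if m = 1 then 1 else (0 :: 'k::comm_ring_1))"
  by (simp add: one_series_def)

lemma series_one_mult [simp]:
  "1 * f = (f :: ('m::unital_magma, 'k::comm_ring_1) series)" "f * 1 = f"
proof -
  show "1 * f = f"
  proof (rule series_eqI)
    fix c
    have "scoeff (1 * f) c = (\<Sum>(a, b) \<in> {(1 :: 'm, c)}. scoeff 1 a * scoeff f b)"
      unfolding scoeff_mult
      by (rule sum.mono_neutral_right) (use finite_factorizations [of c] in \<open>auto simp: scoeff_one split: if_splits\<close>)
    then show "scoeff (1 * f) c = scoeff f c" by (simp add: scoeff_one)
  qed
  show "f * 1 = f"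
  proof (rule series_eqI)
    fix c
    have "scoeff (f * 1) c = (\<Sum>(a, b) \<in> {(c, 1 :: 'm)}. scoeff f a * scoeff 1 b)"
      unfolding scoeff_mult
      by (rule sum.mono_neutral_right) (use finite_factorizations [of c] in \<open>auto simp: scoeff_one split: if_splits\<close>)
    then show "scoeff (f * 1) c = scoeff f c" by (simp add: scoeff_one)
  qed
qed

lemma series_mono_mult: "series_mono u * series_mono v = (series_mono (u * v) :: ('m::unital_magma, 'k::comm_ring_1) series)"
proof (rule series_eqI)
  fix c
  have "scoeff (series_mono u * series_mono v) c =
      (\<Sum>(a, b) \<in> {(a, b). a * b = c} \<inter> {(u, v)}. scoeff (series_mono u) a * (scoeff (series_mono v) b :: 'k))"
    unfolding scoeff_mult
    by (rule sum.mono_neutral_right) (auto simp: finite_factorizations split: if_splits)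
  then show "scoeff (series_mono u * series_mono v) c = (scoeff (series_mono (u * v)) c :: 'k)"
    by (cases "u * v = c") auto
qed

lemma deg_mult: "deg (u * v) = deg u + deg v"
  by (cases u; cases v) auto

lemma deg_eq_0: "deg w = 0 \<longleftrightarrow> w = 1"
  using leaves_pos by (cases w) (auto simp: one_umag_def)

lemma factorizations_umag:
  fixes u v :: "'x mag"
  shows "{(a, b). a * b = 1} = {(1 :: 'x umag, 1)}"
  "{(a, b). a * b = Word (Leaf x)} = {(1 :: 'x umag, Word (Leaf x)), (Word (Leaf x), 1)}"
  "{(a, b). a * b = Word (Node u v)} = {(1, Word (Node u v)), (Word (Node u v), 1), (Word u, Word v)}"
proof -
  have *: "a * b = w \<longleftrightarrow> a = Empty \<and> b = w \<or> a = w \<and> b = Empty \<or>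
      (\<exists>u v. w = Word (Node u v) \<and> a = Word u \<and> b = Word v)" for a b w :: "'x umag"
    by (cases a; cases b) auto
  show "{(a, b). a * b = 1} = {(1 :: 'x umag, 1)}"
    and "{(a, b). a * b = Word (Leaf x)} = {(1, Word (Leaf x)), (Word (Leaf x), 1 :: 'x umag)}"
    and "{(a, b). a * b = Word (Node u v)} = {(1 :: 'x umag, Word (Node u v)), (Word (Node u v), 1), (Word u, Word v)}"
    by (auto simp: one_umag_def *)
qed

lemma scoeff_mult_umag:
  "scoeff (f * g) 1 = scoeff f 1 * scoeff g 1"
  "scoeff (f * g) (Word (Leaf x)) = scoeff f 1 * scoeff g (Word (Leaf x)) + scoeff f (Word (Leaf x)) * scoeff g 1"
  "scoeff (f * g) (Word (Node u v)) = scoeff f 1 * scoeff g (Word (Node u v)) +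
     scoeff f (Word (Node u v)) * scoeff g 1 + scoeff f (Word u) * scoeff g (Word v)"
  by (simp_all add: scoeff_mult factorizations_umag) (simp_all add: one_umag_def)

lemma scoeff_eval_eq_0:
  assumes "\<And>x. scoeff (g x) 1 = 0" "deg w < deg m"
  shows "scoeff (umag_eval g m) w = 0"
proof -
  have "scoeff (mag_eval g u) w = 0" if "deg w < leaves u" for u w
    using that
  proof (induction u arbitrary: w)
    case (Leaf x)
    then show ?case using assms(1) deg_eq_0 [of w] by simp
  next
    case (Node u v)
    have "scoeff (mag_eval g u) a * scoeff (mag_eval g v) b = 0" if "a * b = w" for a b
      using Node deg_mult [of a b] that by (cases "deg a < leaves u") auto
    then show ?case by (auto simp: scoeff_mult intro!: sum.neutral)
  qed
  then show ?thesis using assms(2) by (cases m) auto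
qed

lemma subst_support:
  fixes f :: "('y::finite umag, 'k::comm_ring_1) series" and g :: "'y \<Rightarrow> ('x umag, 'k) series"
  assumes "\<And>x. scoeff (g x) 1 = 0"
  shows "finite {m. scoeff f m * scoeff (umag_eval g m) w \<noteq> 0}"
proof (rule finite_subset [OF _ finite_deg [of "deg w"]])
  show "{m. scoeff f m * scoeff (umag_eval g m) w \<noteq> 0} \<subseteq> {m. deg m \<le> deg w}"
  proof clarify
    fix m assume "scoeff f m * scoeff (umag_eval g m) w \<noteq> 0"
    then have "scoeff (umag_eval g m) w \<noteq> 0" by (metis mult_zero_right)
    then show "deg m \<le> deg w" using scoeff_eval_eq_0 [of g w m, OF assms] by (meson not_le)
  qed
qed

lemma scoeff_deriv_eq_0:
  assumes "deg m \<noteq> Suc (deg w)"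
  shows "scoeff (umag_deriv m) w = (0 :: 'k::comm_ring_1)"
proof -
  have "scoeff (mag_deriv u) w = (0 :: 'k)" if "leaves u \<noteq> Suc (deg w)" for u w
    using that
  proof (induction u arbitrary: w)
    case (Leaf x)
    then show ?case by (auto simp: scoeff_one deg_eq_0)
  next
    case (Node u v)
    have "scoeff (mag_deriv u) a * (if b = Word v then 1 else 0) = (0 :: 'k)"
         "(if a = Word u then 1 else 0) * scoeff (mag_deriv v) b = (0 :: 'k)" if "a * b = w" for a b
      using Node.IH(1) [of a] Node.IH(2) [of b] Node.prems deg_mult [of a b] that by auto
    then have "(\<Sum>(a, b) \<in> {(a, b). a * b = w}. scoeff (mag_deriv u) a * (if b = Word v then 1 else 0)) = (0 :: 'k)"
      "(\<Sum>(a, b) \<in> {(a, b). a * b = w}. (if a = Word u then 1 else 0) * scoeff (mag_deriv v) b) = (0 :: 'k)"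
      by (intro sum.neutral; clarsimp)+
    then show ?case by (simp add: scoeff_mult)
  qed
  then show ?thesis using assms by (cases m) auto
qed

lemma deriv_support:
  fixes f :: "(unit umag, 'a::comm_ring_1) series"
  shows "finite {m. scoeff f m * scoeff (umag_deriv m) w \<noteq> 0}"
proof (rule finite_subset [OF _ finite_deg [of "Suc (deg w)"]])
  show "{m. scoeff f m * scoeff (umag_deriv m) w \<noteq> 0} \<subseteq> {m. deg m \<le> Suc (deg w)}"
  proof clarify
    fix m assume "scoeff f m * scoeff (umag_deriv m) w \<noteq> 0"
    then have "scoeff (umag_deriv m) w \<noteq> (0 :: 'a)" by (metis mult_zero_right)
    then show "deg m \<le> Suc (deg w)" using scoeff_deriv_eq_0 [of m w] by (metis order_refl)
  qed
qed

definition controlled :: "nat \<Rightarrow> ('y umag \<Rightarrow> ('x umag, 'k::zero) series) \<Rightarrow> bool" where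
  "controlled d \<phi> \<longleftrightarrow> (\<forall>m w. deg w + d < deg m \<longrightarrow> scoeff (\<phi> m) w = 0)"

lemma controlled_eval: "(\<And>x. scoeff (g x) 1 = 0) \<Longrightarrow> controlled d (umag_eval g)"
  by (auto simp: controlled_def intro!: scoeff_eval_eq_0)

lemma controlled_deriv: "controlled 1 umag_deriv"
  by (auto simp: controlled_def intro!: scoeff_deriv_eq_0)

lemma controlled_mono: "controlled d series_mono"
  by (auto simp: controlled_def)

lemma scoeff_lin_ext:
  fixes f :: "('y::finite umag, 'k::comm_ring_1) series"
  assumes "controlled d \<phi>" "deg w + d \<le> N"
  shows "scoeff (lin_ext \<phi> f) w = (\<Sum>m | deg m \<le> N. scoeff f m * scoeff (\<phi> m) w)"
proof -
  have "scoeff (lin_ext \<phi> f) w = Sum_any (\<lambda>m. scoeff f m * scoeff (\<phi> m) w)"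
    by (simp add: lin_ext_def Abs_series_inverse)
  also have "\<dots> = (\<Sum>m | deg m \<le> N. scoeff f m * scoeff (\<phi> m) w)"
  proof (rule Sum_any.expand_superset [OF finite_deg], clarify)
    fix m assume "scoeff f m * scoeff (\<phi> m) w \<noteq> 0"
    then have "scoeff (\<phi> m) w \<noteq> 0" by (metis mult_zero_right)
    then show "deg m \<le> N" using assms unfolding controlled_def by (meson le_trans not_le)
  qed
  finally show ?thesis .
qed

lemma lin_ext_linear:
  fixes f :: "('y::finite umag, 'k::comm_ring_1) series"
  assumes "controlled d \<phi>"
  shows "lin_ext \<phi> (f + g) = lin_ext \<phi> f + lin_ext \<phi> g"
    "lin_ext \<phi> (f - g) = lin_ext \<phi> f - lin_ext \<phi> g"
    "lin_ext \<phi> (series_smul c f) = series_smul c (lin_ext \<phi> f)"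
    "lin_ext \<phi> (series_mono m) = \<phi> m"
    "lin_ext \<phi> 1 = \<phi> 1"
proof -
  note l = scoeff_lin_ext [OF assms order_refl]
  show "lin_ext \<phi> (f + g) = lin_ext \<phi> f + lin_ext \<phi> g"
    "lin_ext \<phi> (f - g) = lin_ext \<phi> f - lin_ext \<phi> g"
    "lin_ext \<phi> (series_smul c f) = series_smul c (lin_ext \<phi> f)"
    by (rule series_eqI;
        simp add: l algebra_simps sum.distrib sum_subtractf sum_distrib_left)+
  show *: "lin_ext \<phi> (series_mono m) = \<phi> m" for m
  proof (rule series_eqI)
    fix w
    have "scoeff (lin_ext \<phi> (series_mono m)) w =
        (\<Sum>m' | deg m' \<le> deg w + d + deg m. scoeff (series_mono m) m' * scoeff (\<phi> m') w)"
      by (rule scoeff_lin_ext [OF assms]) simp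
    also have "\<dots> = (\<Sum>m' \<in> {m}. scoeff (series_mono m) m' * scoeff (\<phi> m') w)"
      by (rule sum.mono_neutral_right) (auto simp: finite_deg)
    finally show "scoeff (lin_ext \<phi> (series_mono m)) w = scoeff (\<phi> m) w" by simp
  qed
  show "lin_ext \<phi> 1 = \<phi> 1" by (simp add: one_series_def *)
qed

lemma lin_ext_series_mono: "lin_ext series_mono f = (f :: ('y::finite umag, 'k::comm_ring_1) series)"
proof (rule series_eqI)
  fix w
  have "scoeff (lin_ext series_mono f) w = (\<Sum>m | deg m \<le> deg w. scoeff f m * scoeff (series_mono m) w)"
    by (rule scoeff_lin_ext [OF controlled_mono [of 0]]) simp
  also have "\<dots> = (\<Sum>m \<in> {w}. scoeff f m * scoeff (series_mono m) w)"
    by (rule sum.mono_neutral_right) (auto simp: finite_deg)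
  finally show "scoeff (lin_ext series_mono f) w = scoeff f w" by simp
qed

lemma scoeff_lin_ext_mult:
  fixes f g :: "('y::finite umag, 'k::comm_ring_1) series"
  assumes "controlled d \<phi>" "controlled d \<psi>" "deg w + d \<le> N"
  shows "scoeff (lin_ext \<phi> f * lin_ext \<psi> g) w =
    (\<Sum>a | deg a \<le> N. \<Sum>b | deg b \<le> N. scoeff f a * scoeff g b * scoeff (\<phi> a * \<psi> b) w)"
proof -
  let ?S = "{m :: 'y umag. deg m \<le> N}" and ?F = "{(u, v). u * v = w}"
  have "scoeff (lin_ext \<phi> f * lin_ext \<psi> g) w = (\<Sum>(u, v) \<in> ?F.
      (\<Sum>a\<in>?S. scoeff f a * scoeff (\<phi> a) u) * (\<Sum>b\<in>?S. scoeff g b * scoeff (\<psi> b) v))"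
    unfolding scoeff_mult
  proof (rule sum.cong [OF refl], clarify)
    fix u v assume "w = u * v"
    then have "deg u + d \<le> N" "deg v + d \<le> N" using assms(3) by (auto simp: deg_mult)
    then show "scoeff (lin_ext \<phi> f) u * scoeff (lin_ext \<psi> g) v =
      (\<Sum>a\<in>?S. scoeff f a * scoeff (\<phi> a) u) * (\<Sum>b\<in>?S. scoeff g b * scoeff (\<psi> b) v)"
      by (simp add: scoeff_lin_ext [OF assms(1)] scoeff_lin_ext [OF assms(2)])
  qed
  also have "\<dots> = (\<Sum>p\<in>?F. \<Sum>a\<in>?S. \<Sum>b\<in>?S.
      scoeff f a * scoeff g b * (scoeff (\<phi> a) (fst p) * scoeff (\<psi> b) (snd p)))"
    by (simp add: case_prod_unfold sum_product algebra_simps)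
  also have "\<dots> = (\<Sum>a\<in>?S. \<Sum>p\<in>?F. \<Sum>b\<in>?S.
      scoeff f a * scoeff g b * (scoeff (\<phi> a) (fst p) * scoeff (\<psi> b) (snd p)))"
    by (rule sum.swap)
  also have "\<dots> = (\<Sum>a\<in>?S. \<Sum>b\<in>?S. \<Sum>p\<in>?F.
      scoeff f a * scoeff g b * (scoeff (\<phi> a) (fst p) * scoeff (\<psi> b) (snd p)))"
    by (intro sum.cong [OF refl] sum.swap)
  also have "\<dots> = (\<Sum>a\<in>?S. \<Sum>b\<in>?S. scoeff f a * scoeff g b * scoeff (\<phi> a * \<psi> b) w)"
    by (simp add: scoeff_mult case_prod_unfold sum_distrib_left)
  finally show ?thesis .
qed

lemma scoeff_lin_ext_of_mult:
  fixes f g :: "('y::finite umag, 'k::comm_ring_1) series"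
  assumes "controlled d \<chi>" "deg w + d \<le> N"
  shows "scoeff (lin_ext \<chi> (f * g)) w =
    (\<Sum>a | deg a \<le> N. \<Sum>b | deg b \<le> N. scoeff f a * scoeff g b * scoeff (\<chi> (a * b)) w)"
proof -
  let ?S = "{m :: 'y umag. deg m \<le> N}"
  let ?h = "\<lambda>p. scoeff f (fst p) * scoeff g (snd p) * scoeff (\<chi> (fst p * snd p)) w"
  have "scoeff (lin_ext \<chi> (f * g)) w = (\<Sum>m\<in>?S. scoeff (f * g) m * scoeff (\<chi> m) w)"
    by (rule scoeff_lin_ext [OF assms])
  also have "\<dots> = (\<Sum>m\<in>?S. sum ?h {(a, b). a * b = m})"
    unfolding scoeff_mult sum_distrib_right
    by (intro sum.cong refl) (auto simp: algebra_simps)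
  also have "\<dots> = (\<Sum>m\<in>?S. sum ?h {p \<in> ?S \<times> ?S. fst p * snd p = m})"
    by (rule sum.cong [OF refl], rule arg_cong [where f = "sum ?h"]) (auto simp: deg_mult)
  also have "\<dots> = (\<Sum>m\<in>?S. sum ?h {p \<in> {p \<in> ?S \<times> ?S. fst p * snd p \<in> ?S}. fst p * snd p = m})"
    by (rule sum.cong [OF refl], rule arg_cong [where f = "sum ?h"]) auto
  also have "\<dots> = sum ?h {p \<in> ?S \<times> ?S. fst p * snd p \<in> ?S}"
    by (rule sum.group) (auto intro: finite_deg finite_subset [of _ "?S \<times> ?S"])
  also have "\<dots> = sum ?h (?S \<times> ?S)"
  proof (rule sum.mono_neutral_left)
    show "\<forall>p \<in> ?S \<times> ?S - {p \<in> ?S \<times> ?S. fst p * snd p \<in> ?S}. ?h p = 0"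
    proof
      fix p assume "p \<in> ?S \<times> ?S - {p \<in> ?S \<times> ?S. fst p * snd p \<in> ?S}"
      then have "deg w + d < deg (fst p * snd p)" using assms(2) by auto
      then show "?h p = 0" using assms(1) by (simp add: controlled_def)
    qed
  qed (auto intro: finite_deg)
  finally show ?thesis by (simp add: sum.cartesian_product case_prod_unfold)
qed

lemma subst_mult:
  fixes f h :: "('y::finite umag, 'k::comm_ring_1) series" and g :: "'y \<Rightarrow> ('x umag, 'k) series"
  assumes "\<And>x. scoeff (g x) 1 = 0"
  shows "lin_ext (umag_eval g) (f * h) = lin_ext (umag_eval g) f * lin_ext (umag_eval g) h"
proof (rule series_eqI)
  fix w
  note c = controlled_eval [of g 0, OF assms]
  show "scoeff (lin_ext (umag_eval g) (f * h)) w = scoeff (lin_ext (umag_eval g) f * lin_ext (umag_eval g) h) w"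
    by (simp add: scoeff_lin_ext_of_mult [OF c order_refl] scoeff_lin_ext_mult [OF c c order_refl]
        umag_eval_mult)
qed

lemma umag_deriv_mult:
  "umag_deriv (u * v) = umag_deriv u * series_mono v + series_mono u * umag_deriv v"
proof -
  have "series_mono Empty = (1 :: (unit umag, 'a) series)" by (simp add: one_series_def one_umag_def)
  moreover have "0 * f = 0" "f * 0 = 0" for f :: "(unit umag, 'a) series"
    by (rule series_eqI; simp add: scoeff_mult)+
  ultimately show ?thesis by (cases u; cases v) auto
qed

theorem series_deriv_mult: "series_deriv (f * g) = series_deriv f * g + f * series_deriv g"
proof (rule series_eqI)
  fix w
  note c = controlled_deriv controlled_mono [of 1]
  have "scoeff (series_deriv f * lin_ext series_mono g + lin_ext series_mono f * series_deriv g) w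
      = scoeff (series_deriv (f * g)) w"
    unfolding series_deriv_def scoeff_simps
    by (simp add: scoeff_lin_ext_of_mult [OF c(1) order_refl]
      scoeff_lin_ext_mult [OF c order_refl] scoeff_lin_ext_mult [OF c(2,1) order_refl]
      umag_deriv_mult algebra_simps sum.distrib)
  then show "scoeff (series_deriv (f * g)) w = scoeff (series_deriv f * g + f * series_deriv g) w"
    by (simp add: lin_ext_series_mono)
qed

theorem series_deriv_ivar: "series_deriv ivar = 1"
  by (simp add: series_deriv_def series_var_def lin_ext_linear [OF controlled_deriv])

subsection \<open>Composition\<close>

lemma comp_simps:
  assumes "scoeff h 1 = 0"
  shows "series_comp (f + g) h = series_comp f h + series_comp g h"
    "series_comp (f - g) h = series_comp f h - series_comp g h"
    "series_comp (series_smul c f) h = series_smul c (series_comp f h)"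
    "series_comp (f * g) h = series_comp f h * series_comp g h"
    "series_comp 1 h = 1" "series_comp ivar h = h"
  unfolding series_comp_def
  using assms by (simp_all add: lin_ext_linear [OF controlled_eval [of _ 0]] subst_mult series_var_def)
    (simp add: one_umag_def)

lemma scoeff_comp_1: "scoeff h 1 = 0 \<Longrightarrow> scoeff (series_comp f h) 1 = scoeff f 1"
proof -
  assume h: "scoeff h 1 = 0"
  have *: "{m. deg m \<le> 0} = {1}" by (auto simp: deg_eq_0)
  have "scoeff (series_comp f h) 1 = (\<Sum>m | deg m \<le> 0. scoeff f m * scoeff (umag_eval (\<lambda>_. h) m) 1)"
    unfolding series_comp_def
    by (rule scoeff_lin_ext [OF controlled_eval [of _ 0]]) (use h in \<open>auto simp: deg_eq_0\<close>)
  then show ?thesis unfolding * by (simp add: one_umag_def scoeff_one)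
qed

lemma comp_assoc:
  fixes f g :: "(unit umag, 'k::comm_ring_1) series" and h :: "('x umag, 'k) series"
  assumes g: "scoeff g 1 = 0" and h: "scoeff h 1 = 0"
  shows "series_comp (series_comp f g) h = series_comp f (series_comp g h)"
proof (rule series_eqI)
  fix w :: "'x umag"
  let ?S = "{m :: unit umag. deg m \<le> deg w}" and ?gh = "series_comp g h"
  have gh: "scoeff ?gh 1 = 0" using g h by (simp add: scoeff_comp_1)
  note cg = controlled_eval [of "\<lambda>_. g" 0, OF g] and ch = controlled_eval [of "\<lambda>_. h" 0, OF h]
    and cgh = controlled_eval [of "\<lambda>_. ?gh" 0, OF gh]
  have eval: "series_comp (umag_eval (\<lambda>_. g) m) h = umag_eval (\<lambda>_. ?gh) m" for m :: "unit umag"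
  proof -
    have "series_comp (mag_eval (\<lambda>_. g) u) h = mag_eval (\<lambda>_. ?gh) u" for u :: "unit mag"
      by (induction u) (auto simp: comp_simps [OF h])
    then show ?thesis by (cases m) (auto simp: comp_simps [OF h])
  qed
  have "scoeff (series_comp (series_comp f g) h) w =
      (\<Sum>m\<in>?S. scoeff (series_comp f g) m * scoeff (umag_eval (\<lambda>_. h) m) w)"
    unfolding series_comp_def by (rule scoeff_lin_ext [OF ch]) simp
  also have "\<dots> = (\<Sum>m\<in>?S. \<Sum>k\<in>?S. scoeff f k * (scoeff (umag_eval (\<lambda>_. g) k) m * scoeff (umag_eval (\<lambda>_. h) m) w))"
    unfolding series_comp_def
    by (rule sum.cong [OF refl]) (simp add: scoeff_lin_ext [OF cg, of _ "deg w"] sum_distrib_right mult.assoc)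
  also have "\<dots> = (\<Sum>k\<in>?S. \<Sum>m\<in>?S. scoeff f k * (scoeff (umag_eval (\<lambda>_. g) k) m * scoeff (umag_eval (\<lambda>_. h) m) w))"
    by (rule sum.swap)
  also have "\<dots> = (\<Sum>k\<in>?S. scoeff f k * scoeff (series_comp (umag_eval (\<lambda>_. g) k) h) w)"
    unfolding series_comp_def
    by (simp add: scoeff_lin_ext [OF ch order_refl] sum_distrib_left)
  also have "\<dots> = scoeff (series_comp f ?gh) w"
    unfolding eval unfolding series_comp_def [of f]
    by (simp add: scoeff_lin_ext [OF cgh order_refl])
  finally show "scoeff (series_comp (series_comp f g) h) w = scoeff (series_comp f ?gh) w" .
qed

subsection \<open>Exponential\<close>

lemma scoeff_comp_smul: "scoeff (series_comp f (series_smul c ivar)) w = c ^ deg w * scoeff f w"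
proof -
  have ev: "umag_eval (\<lambda>_. series_smul c ivar) m = series_smul (c ^ deg m) (series_mono m)" for m :: "unit umag"
  proof -
    have sm: "series_smul a f * series_smul b g = series_smul (a * b) (f * g)" for a b :: 'a and f g :: "(unit umag, 'a) series"
      by (rule series_eqI) (simp add: scoeff_mult sum_distrib_left case_prod_unfold algebra_simps)
    have "mag_eval (\<lambda>_. series_smul c ivar) u = series_smul (c ^ leaves u) (series_mono (Word u))" for u :: "unit mag"
      by (induction u) (auto simp: series_var_def sm series_mono_mult power_add)
    moreover have "series_smul 1 f = f" for f :: "(unit umag, 'a) series" by (rule series_eqI) simp
    ultimately show ?thesis by (cases m) (auto simp: one_series_def one_umag_def)
  qed
  have "scoeff (series_comp f (series_smul c ivar)) w = (\<Sum>m | deg m \<le> deg w. scoeff f m * scoeff (umag_eval (\<lambda>_. series_smul c ivar) m) w)"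
    unfolding series_comp_def
    by (rule scoeff_lin_ext [OF controlled_eval [of _ 0]]) (auto simp: series_var_def one_umag_def)
  also have "\<dots> = (\<Sum>m \<in> {w}. scoeff f m * scoeff (umag_eval (\<lambda>_. series_smul c ivar) m) w)"
    by (rule sum.mono_neutral_right) (auto simp: finite_deg ev)
  finally show ?thesis by (simp add: ev)
qed

primrec exp_mag :: "unit mag \<Rightarrow> 'k::field_char_0" where
  "exp_mag (Leaf _) = 1"
| "exp_mag (Node u v) = exp_mag u * exp_mag v / (2 ^ (leaves u + leaves v) - 2)"

lemma leaves_Node: "(2 :: 'k::field_char_0) ^ (leaves u + leaves v) - 2 \<noteq> 0" "(2 :: 'k::field_char_0) ^ (leaves u + leaves v) - 1 \<noteq> 0"
proof -
  have "leaves u + leaves v \<ge> 2" using leaves_pos [of u] leaves_pos [of v] by simp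
  then obtain n where n: "leaves u + leaves v = Suc (Suc n)" by (metis add_2_eq_Suc le_Suc_ex)
  have "(1::nat) \<le> 2 ^ n" by simp
  then have "(2::nat) ^ (leaves u + leaves v) \<noteq> 2" "(2::nat) ^ (leaves u + leaves v) \<noteq> 1"
    unfolding n power_Suc by linarith+
  then have "of_nat (2 ^ (leaves u + leaves v)) \<noteq> (of_nat 2 :: 'k)" "of_nat (2 ^ (leaves u + leaves v)) \<noteq> (of_nat 1 :: 'k)"
    unfolding of_nat_eq_iff by auto
  then show "(2 :: 'k) ^ (leaves u + leaves v) - 2 \<noteq> 0" "(2 :: 'k) ^ (leaves u + leaves v) - 1 \<noteq> 0"
    by auto
qed

lemma mult_eq_double:
  fixes f g :: "(unit umag, 'k::field_char_0) series"
  assumes 1: "scoeff e 1 = 1" and eq: "e * e = series_comp e (series_smul 2 ivar)"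
  shows "scoeff e (Word (Node u v)) = scoeff e (Word u) * scoeff e (Word v) / ((2 :: 'k::field_char_0) ^ (leaves u + leaves v) - 2)"
proof -
  have "scoeff (e * e) (Word (Node u v)) = scoeff (series_comp e (series_smul 2 ivar)) (Word (Node u v))"
    using eq by simp
  then have "scoeff e (Word u) * scoeff e (Word v) = (2 ^ (leaves u + leaves v) - 2) * scoeff e (Word (Node u v))"
    by (simp add: scoeff_mult_umag scoeff_comp_smul 1 algebra_simps)
  then show ?thesis using leaves_Node(1) [where 'k = 'k, of u v] by (simp add: field_simps)
qed

lemma scoeff_deriv_1: "scoeff (series_deriv f) 1 = scoeff f (Word (Leaf ()))"
proof -
  have "{m :: unit umag. deg m \<le> 1} = {Empty, Word (Leaf ())}"
  proof -
    have "m \<in> {Empty, Word (Leaf ())}" if "deg m \<le> 1" for m :: "unit umag"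
    proof (cases m)
      case (Word u)
      show ?thesis
      proof (cases u)
        case (Node a b)
        then show ?thesis using that Word leaves_pos [of a] leaves_pos [of b] by simp
      qed (simp add: Word)
    qed auto
    then show ?thesis by auto
  qed
  then show ?thesis
    unfolding series_deriv_def
    by (subst scoeff_lin_ext [OF controlled_deriv, of _ 1]) (auto simp: one_umag_def scoeff_one)
qed

theorem ex1_nexp: "\<exists>!e :: (unit umag, 'k::field_char_0) series. is_nexp e"
proof (rule ex_ex1I)
  define e :: "(unit umag, 'k) series" where "e = Abs_series (\<lambda>w. case w of Empty \<Rightarrow> 1 | Word u \<Rightarrow> exp_mag u)"
  have e: "scoeff e 1 = 1" "scoeff e (Word u) = exp_mag u" for u
    by (simp_all add: e_def Abs_series_inverse one_umag_def)
  have ee: "e * e = series_comp e (series_smul 2 ivar)"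
  proof (rule series_eqI)
    fix w :: "unit umag"
    consider "w = 1" | x where "w = Word (Leaf x)" | u v where "w = Word (Node u v)"
      by (metis one_umag_def mag.exhaust umag.exhaust)
    then show "scoeff (e * e) w = scoeff (series_comp e (series_smul 2 ivar)) w"
    proof cases
      case (3 u v)
      have "2 * (t / (q - 2)) + t = q * (t / (q - 2))" if "q - 2 \<noteq> 0" for t q :: 'k
        using that by (simp add: field_simps)
      from this [OF leaves_Node(1)] show ?thesis
        by (simp add: 3 scoeff_mult_umag scoeff_comp_smul e)
    qed (simp_all add: scoeff_mult_umag scoeff_comp_smul e deg_eq_0 [THEN iffD2])
  qed
  define d where "d = series_deriv e"
  have d2: "d * e + e * d = series_smul 2 (series_comp d (series_smul 2 ivar))"
  proof -
    have "series_deriv (series_comp f (series_smul c ivar)) = series_smul c (series_comp (series_deriv f) (series_smul c ivar))"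
      for c :: 'k and f :: "(unit umag, 'k) series"
    proof -
      show ?thesis
      proof (rule series_eqI)
        fix w
        have "(\<Sum>m | deg m \<le> Suc (deg w). (c ^ deg m * scoeff f m) * scoeff (umag_deriv m) w) =
          (\<Sum>m | deg m \<le> Suc (deg w). c * c ^ deg w * (scoeff f m * scoeff (umag_deriv m) w))"
        proof (rule sum.cong [OF refl])
          fix m
          show "(c ^ deg m * scoeff f m) * scoeff (umag_deriv m) w = c * c ^ deg w * (scoeff f m * scoeff (umag_deriv m) w)"
            by (cases "deg m = Suc (deg w)") (auto simp: scoeff_deriv_eq_0)
        qed
        then show "scoeff (series_deriv (series_comp f (series_smul c ivar))) w =
          scoeff (series_smul c (series_comp (series_deriv f) (series_smul c ivar))) w"
          by (simp add: scoeff_comp_smul)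
            (simp add: series_deriv_def scoeff_lin_ext [OF controlled_deriv, of w "Suc (deg w)"]
             scoeff_comp_smul sum_distrib_left mult.assoc)
      qed
    qed
    then show ?thesis using series_deriv_mult [of e e] by (simp add: ee d_def)
  qed
  have "d = e"
  proof -
    have d1: "scoeff d 1 = 1" by (simp add: d_def scoeff_deriv_1 e)
    have "scoeff d (Word u) = exp_mag u" for u
    proof (induction u)
      case (Leaf x)
      have "scoeff (d * e + e * d) (Word (Leaf x)) = 4 * scoeff d (Word (Leaf x))"
        unfolding d2 by (simp add: scoeff_comp_smul)
      then show ?case by (simp add: scoeff_mult_umag d1 e)
    next
      case (Node u v)
      let ?q = "2 ^ (leaves u + leaves v) :: 'k" and ?w = "Word (Node u v)"
      have "scoeff (d * e + e * d) ?w = 2 * (?q * scoeff d ?w)"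
        unfolding d2 by (simp add: scoeff_comp_smul)
      then have "2 * (exp_mag u * exp_mag v / (?q - 2) + exp_mag u * exp_mag v) = 2 * ((?q - 1) * scoeff d ?w)"
        by (simp add: scoeff_mult_umag d1 e Node algebra_simps)
      then have "exp_mag u * exp_mag v / (?q - 2) + exp_mag u * exp_mag v = (?q - 1) * scoeff d ?w"
        unfolding mult_cancel_left by simp
      moreover have "t / (?q - 2) + t = (?q - 1) * (t / (?q - 2))" for t
        using leaves_Node(1) [where 'k = 'k, of u v] by (simp add: field_simps)
      ultimately have "(?q - 1) * (exp_mag u * exp_mag v / (?q - 2)) = (?q - 1) * scoeff d ?w" by metis
      then show ?case using leaves_Node(2) [where 'k = 'k, of u v]
        unfolding mult_cancel_left by simp
    qed
    then show ?thesis
      by (intro series_eqI) (metis d1 e one_umag_def umag.exhaust)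
  qed
  then show "\<exists>e :: (unit umag, 'k) series. is_nexp e"
    using e ee unfolding is_nexp_def d_def by auto
next
  fix e e' :: "(unit umag, 'k) series"
  assume "is_nexp e" "is_nexp e'"
  then have e: "scoeff e 1 = 1" "e * e = series_comp e (series_smul 2 ivar)" "scoeff e (Word (Leaf ())) = 1"
    and e': "scoeff e' 1 = 1" "e' * e' = series_comp e' (series_smul 2 ivar)" "scoeff e' (Word (Leaf ())) = 1"
    using scoeff_deriv_1 [of e] scoeff_deriv_1 [of e'] by (auto simp: is_nexp_def)
  have "scoeff e (Word u) = scoeff e' (Word u)" for u
    by (induction u) (auto simp: e e' mult_eq_double [OF e(1,2)] mult_eq_double [OF e'(1,2)])
  then show "e = e'"
    by (intro series_eqI) (metis e(1) e'(1) one_umag_def umag.exhaust)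
qed

lemma is_nexp_nexp: "is_nexp (nexp :: (unit umag, 'k::field_char_0) series)"
  unfolding nexp_def by (rule theI' [OF ex1_nexp])

subsection \<open>Logarithm\<close>

lemma comp_ivar: "series_comp f ivar = f"
proof (rule series_eqI)
  have "series_smul 1 g = g" for g :: "(unit umag, 'a) series" by (rule series_eqI) simp
  then show "scoeff (series_comp f ivar) w = scoeff f w" for w
    using scoeff_comp_smul [of f 1 w] by simp
qed

lemma scoeff_eval_cong:
  assumes "scoeff g 1 = 0" "scoeff g' 1 = 0" "\<And>w. deg w \<le> n \<Longrightarrow> scoeff g w = scoeff g' w"
    and "deg w \<le> n + deg m - 1" "deg m > 0"
  shows "scoeff (umag_eval (\<lambda>_. g) m) w = scoeff (umag_eval (\<lambda>_. g') m) w"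
proof -
  have "scoeff (mag_eval (\<lambda>_. g) u) w = scoeff (mag_eval (\<lambda>_. g') u) w" if "deg w \<le> n + leaves u - 1" for u w
    using that
  proof (induction u arbitrary: w)
    case (Leaf x)
    then show ?case using assms by simp
  next
    case (Node u v)
    note z = scoeff_eval_eq_0 [of "\<lambda>_. g", OF assms(1), of _ "Word _"] scoeff_eval_eq_0 [of "\<lambda>_. g'", OF assms(2), of _ "Word _"]
    have "scoeff (mag_eval (\<lambda>_. g) u) a * scoeff (mag_eval (\<lambda>_. g) v) b =
      scoeff (mag_eval (\<lambda>_. g') u) a * scoeff (mag_eval (\<lambda>_. g') v) b" if "a * b = w" for a b
    proof (cases "deg a < leaves u \<or> deg b < leaves v")
      case True
      then show ?thesis using z [of a u] z [of b v] by auto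
    next
      case False
      then have "deg a \<le> n + leaves u - 1" "deg b \<le> n + leaves v - 1"
        using Node.prems deg_mult [of a b] that by auto
      then show ?thesis using Node.IH by simp
    qed
    then show ?case by (auto simp: scoeff_mult intro!: sum.cong)
  qed
  then show ?thesis using assms(4,5) by (cases m) auto
qed

lemma ex_right_inverse:
  fixes F :: "(unit umag, 'k::comm_ring_1) series"
  assumes F1: "scoeff F 1 = 0" and Fx: "scoeff F (Word (Leaf ())) = 1"
  shows "\<exists>l. scoeff l 1 = 0 \<and> scoeff l (Word (Leaf ())) = 1 \<and> series_comp F l = ivar"
proof -
  define G where "G = F - ivar"
  have G: "scoeff G w = 0" if "deg w \<le> 1" for w
  proof -
    have "w = 1 \<or> w = Word (Leaf ())"
    proof (cases w)
      case (Word u)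
      show ?thesis
      proof (cases u)
        case (Node a b)
        then show ?thesis using that Word leaves_pos [of a] leaves_pos [of b] by simp
      qed (simp add: Word)
    qed (simp add: one_umag_def)
    then show ?thesis using assms by (auto simp: G_def series_var_def one_umag_def)
  qed
  have G1: "scoeff G 1 = 0" by (rule G) (simp add: one_umag_def)
  define it where "it = rec_nat 0 (\<lambda>_ l. ivar - series_comp G l)"
  have it: "it 0 = 0" "it (Suc k) = ivar - series_comp G (it k)" for k
    by (simp_all add: it_def)
  have it1: "scoeff (it k) 1 = 0" for k
  proof (induction k)
    case (Suc k)
    then show ?case by (simp add: it scoeff_comp_1 G1) (simp add: series_var_def one_umag_def)
  qed (simp add: it)
  have cong: "scoeff (series_comp G g) w = scoeff (series_comp G g') w"
    if "scoeff g 1 = 0" "scoeff g' 1 = 0" "\<And>w. deg w \<le> n \<Longrightarrow> scoeff g w = scoeff g' w" "deg w \<le> Suc n"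
    for g g' n and w :: "unit umag"
  proof -
    have "scoeff G m * scoeff (umag_eval (\<lambda>_. g) m) w = scoeff G m * scoeff (umag_eval (\<lambda>_. g') m) w" for m
    proof (cases "deg m \<le> 1")
      case False
      then have "scoeff (umag_eval (\<lambda>_. g) m) w = scoeff (umag_eval (\<lambda>_. g') m) w"
        using that by (intro scoeff_eval_cong [of g g' n]) auto
      then show ?thesis by simp
    qed (simp add: G)
    then show ?thesis using that(1,2)
      by (simp add: series_comp_def scoeff_lin_ext [OF controlled_eval [of _ 0] order_refl])
  qed
  have it_coeff: "scoeff (it (Suc k)) w =
      scoeff ivar w - scoeff (series_comp G (it k)) w" for k w
    by (simp add: it)
  have step: "deg w \<le> k \<Longrightarrow> scoeff (it k) w = scoeff (it (Suc k)) w" for k w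
  proof (induction k arbitrary: w)
    case 0
    then have "w = 1" by (simp add: deg_eq_0)
    then show ?case using it1 by simp
  next
    case (Suc k)
    have "scoeff (series_comp G (it k)) w = scoeff (series_comp G (it (Suc k))) w"
      by (rule cong [of _ _ k]) (use Suc it1 in auto)
    then show ?case using it_coeff [of k w] it_coeff [of "Suc k" w] by metis
  qed
  have stable: "scoeff (it (k + j)) w = scoeff (it k) w" if "deg w \<le> k" for j k w
  proof (induction j)
    case (Suc j)
    then show ?case using step [of w "k + j"] that by simp
  qed simp
  define l where "l = Abs_series (\<lambda>w. scoeff (it (deg w)) w)"
  have l: "scoeff l w = scoeff (it k) w" if "deg w \<le> k" for w k
    using stable [OF order_refl, of w "k - deg w"] that by (simp add: l_def Abs_series_inverse)
  have l1: "scoeff l 1 = 0" using l [of 1 "deg 1"] it1 by auto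
  have l_eq: "l = ivar - series_comp G l"
  proof (rule series_eqI)
    fix w
    have "scoeff l w = scoeff (it (Suc (deg w))) w" by (rule l) simp
    also have "\<dots> = scoeff ivar w - scoeff (series_comp G (it (deg w))) w" by (simp add: it)
    also have "scoeff (series_comp G (it (deg w))) w = scoeff (series_comp G l) w"
      by (rule cong [of _ _ "deg w"]) (simp_all add: it1 l1 l [symmetric])
    finally show "scoeff l w = scoeff (ivar - series_comp G l) w" by simp
  qed
  have "F = ivar + G" by (simp add: G_def)
  then have "series_comp F l = l + series_comp G l"
    using l1 by (simp add: comp_simps)
  also have "\<dots> = ivar" using l_eq by (metis diff_add_cancel)
  finally have "series_comp F l = ivar" .
  moreover have "scoeff l (Word (Leaf ())) = 1"
  proof -
    have "scoeff l (Word (Leaf ())) = scoeff (it 1) (Word (Leaf ()))" by (rule l) simp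
    also have "\<dots> = 1 - scoeff (series_comp G 0) (Word (Leaf ()))" by (simp add: it series_var_def)
    also have "scoeff (series_comp G 0) (Word (Leaf ())) = 0"
    proof -
      have "scoeff G m * scoeff (umag_eval (\<lambda>_. 0) m) (Word (Leaf ())) = 0" for m
        using G [of m] scoeff_eval_eq_0 [of "\<lambda>_::unit. 0 :: (unit umag, 'k) series" "Word (Leaf ())" m] by (cases "deg m \<le> 1") auto
      then show ?thesis by (simp add: series_comp_def lin_ext_def Abs_series_inverse)
    qed
    finally show ?thesis by simp
  qed
  ultimately show ?thesis using l1 by blast
qed

theorem ex1_nlog1p: "\<exists>!l :: (unit umag, 'k::field_char_0) series. is_nlog1p l"
proof (rule ex_ex1I)
  let ?E = "nexp - 1 :: (unit umag, 'k) series"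
  have E: "scoeff ?E 1 = 0" "scoeff ?E (Word (Leaf ())) = 1"
    using is_nexp_nexp [where 'k = 'k] scoeff_deriv_1 [of "nexp :: (unit umag, 'k) series"]
    by (auto simp: is_nexp_def scoeff_one one_umag_def)
  obtain l where l: "scoeff l 1 = 0" "scoeff l (Word (Leaf ())) = 1" "series_comp ?E l = ivar"
    using ex_right_inverse [OF E] by blast
  obtain F where F: "scoeff F 1 = 0" "series_comp l F = ivar"
    using ex_right_inverse [OF l(1,2)] by blast
  have "F = series_comp (series_comp ?E l) F" by (simp only: l(3) comp_simps(6) [OF F(1)])
  also have "\<dots> = ?E" by (simp only: comp_assoc [OF l(1) F(1)] F(2) comp_ivar)
  finally show "\<exists>l :: (unit umag, 'k) series. is_nlog1p l"
    using l F unfolding is_nlog1p_def by blast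
  fix k k' :: "(unit umag, 'k) series"
  assume "is_nlog1p k" "is_nlog1p k'"
  then have k: "scoeff k 1 = 0" "series_comp k ?E = ivar" and k': "scoeff k' 1 = 0" "series_comp ?E k' = ivar"
    by (auto simp: is_nlog1p_def)
  have "k = series_comp k (series_comp ?E k')" by (simp add: k' comp_ivar)
  also have "\<dots> = series_comp (series_comp k ?E) k'" by (simp only: comp_assoc [OF E(1) k'(1)])
  also have "\<dots> = k'" by (simp add: k k' comp_simps)
  finally show "k = k'" .
qed

lemma is_nlog1p_nlog1p: "is_nlog1p (nlog1p :: (unit umag, 'k::field_char_0) series)"
  unfolding nlog1p_def by (rule theI' [OF ex1_nlog1p])

theorem hausdorff_iff:
  fixes h :: "(xy umag, 'k::field_char_0) series"
  shows "h = hausdorff \<longleftrightarrow> scoeff h 1 = 0 \<and>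
    series_comp nexp h = series_comp nexp (series_var Var_x) * series_comp nexp (series_var Var_y)"
proof -
  let ?E = "nexp - 1 :: (unit umag, 'k) series" and ?L = "nlog1p :: (unit umag, 'k) series"
  let ?P = "series_comp nexp (series_var Var_x) * series_comp nexp (series_var Var_y) :: (xy umag, 'k) series"
  have E: "scoeff ?E 1 = 0" using is_nexp_nexp [where 'k = 'k] by (simp add: is_nexp_def scoeff_one)
  have L: "scoeff ?L 1 = 0" "series_comp ?L ?E = ivar" "series_comp ?E ?L = ivar"
    using is_nlog1p_nlog1p [where 'k = 'k] by (auto simp: is_nlog1p_def)
  have v: "scoeff (series_var x :: (xy umag, 'k) series) 1 = 0" for x
    by (simp add: series_var_def one_umag_def)
  have "scoeff (nexp :: (unit umag, 'k) series) 1 = 1"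
    using is_nexp_nexp [where 'k = 'k] by (simp add: is_nexp_def)
  then have P: "scoeff (?P - 1) 1 = 0"
    by (simp add: scoeff_mult_umag scoeff_comp_1 v scoeff_one)
  have H: "hausdorff = series_comp ?L (?P - 1)" by (simp add: hausdorff_def nlog_def)
  show ?thesis
  proof
    assume "h = hausdorff"
    then have h: "h = series_comp ?L (?P - 1)" using H by simp
    have h1: "scoeff h 1 = 0" by (simp only: h scoeff_comp_1 [OF P] L(1))
    have "series_comp nexp h - 1 = series_comp ?E h" by (simp add: comp_simps h1)
    also have "\<dots> = ?P - 1" unfolding h comp_assoc [OF L(1) P, symmetric] by (simp only: L(3) comp_simps(6) [OF P])
    finally show "scoeff h 1 = 0 \<and> series_comp nexp h = ?P" using h1 by simp
  next
    assume a: "scoeff h 1 = 0 \<and> series_comp nexp h = ?P"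
    then have "series_comp ?E h = ?P - 1" by (simp add: comp_simps)
    then have "series_comp (series_comp ?L ?E) h = hausdorff"
      using a by (simp only: comp_assoc [OF E] H)
    then show "h = hausdorff" using a by (simp add: L comp_simps)
  qed
qed
end

theory Submission
  imports Defs
begin

text \<open>The proof follows the associative one: the exponential is group-like, group-like elements are
  closed under products, and the logarithm of a group-like element is primitive. What has to be
  replaced is the argument for the first of these facts, since without associativity the identity
  $\exp(s + t) = \exp(s)\exp(t)$ fails in general even for commuting $s$, $t$.

  All series that occur are families of coefficients indexed by a graded magma: the words, or the
  pairs of words for the completed tensor square. An assignment of series to the elements of such a
  magma that is multiplicative and does not lower degrees extends to a continuous algebra
  homomorphism (\<open>lin_ext_mult\<close>), and such extensions compose (\<open>lin_ext_subst\<close>). Substitution of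
  a series without constant term, the co-addition \<open>\<Delta>\<close> of series and the map
  $f \otimes g \mapsto f(h) \otimes g(h)$ are all instances.

  In one variable, both $\Delta(\exp)$ and $\exp \otimes \exp$ have constant term $1$, agree in degree
  $1$, and satisfy the doubling equation: the square of the series is obtained by multiplying its
  component of degree \<open>n\<close> by $2^n$. This equation determines the components of degree
  $n \ge 2$ from the lower ones, as it reads $(2^n - 2) E_n = \sum_{0<i<n} E_i E_{n-i}$
  (\<open>doubling_unique\<close>). Hence $\Delta(\exp) = \exp \otimes \exp$ (\<open>series_coaddition_nexp\<close>).
  Applying $f \otimes g \mapsto f(h) \otimes g(h)$ to it gives
  $\exp(h \otimes 1 + 1 \otimes h) = \exp(h) \otimes \exp(h)$ for every series \<open>h\<close> without constant
  term (\<open>nexp_primitive_tensor\<close>).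

  Then, with $P = H \otimes 1 + 1 \otimes H$,
  \[ \exp(\Delta(H)) = \Delta(\exp(x)) \Delta(\exp(y))
     = (\exp(x) \otimes \exp(x)) (\exp(y) \otimes \exp(y)) = \exp(H) \otimes \exp(H) = \exp(P), \]
  and taking logarithms in the tensor square (\<open>series_at_nexp_inject\<close>) gives $\Delta(H) = P$.
  Since \<open>\<Delta>\<close> preserves degrees, this equation splits into its homogeneous components.\<close>


section \<open>Graded magmas\<close>

text \<open>Words and pairs of words are treated uniformly. Finiteness of each degree makes the coefficients
  of a continuous linear extension finite sums; words in finitely many letters have it.\<close>

class graded_magma = unital_magma +
  fixes mdeg :: "'a \<Rightarrow> nat"
  assumes mdeg_mult: "mdeg (a * b) = mdeg a + mdeg b"
    and mdeg_eq_0: "mdeg a = 0 \<longleftrightarrow> a = 1"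
    and finite_mdeg: "finite {a. mdeg a \<le> n}"

instantiation umag :: (finite) graded_magma
begin

definition mdeg_umag :: "'a umag \<Rightarrow> nat" where
  "mdeg_umag = deg"

instance
  by standard (simp_all add: mdeg_umag_def deg_mult deg_eq_0 finite_deg)

end

instantiation prod :: (graded_magma, graded_magma) graded_magma
begin

definition mdeg_prod :: "'a \<times> 'b \<Rightarrow> nat" where
  "mdeg_prod p = mdeg (fst p) + mdeg (snd p)"

instance
proof
  fix p q :: "'a \<times> 'b" and n
  show "mdeg (p * q) = mdeg p + mdeg q"
    by (simp add: mdeg_prod_def times_prod_def mdeg_mult)
  show "mdeg p = 0 \<longleftrightarrow> p = 1"
    by (cases p) (simp add: mdeg_prod_def one_prod_def mdeg_eq_0)
  have "{p :: 'a \<times> 'b. mdeg p \<le> n} \<subseteq> {a. mdeg a \<le> n} \<times> {b. mdeg b \<le> n}"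
    by (auto simp: mdeg_prod_def)
  then show "finite {p :: 'a \<times> 'b. mdeg p \<le> n}"
    by (rule finite_subset) (intro finite_cartesian_product finite_mdeg)
qed

end

lemma mdeg_one [simp]: "mdeg 1 = 0"
  by (simp add: mdeg_eq_0)


section \<open>Continuous homomorphisms of series algebras\<close>

text \<open>No term of \<open>\<phi> m\<close> has smaller degree than \<open>m\<close>, so only finitely many \<open>m\<close> contribute to a
  given coefficient of the extension of \<open>\<phi>\<close> to series.\<close>

definition degree_raising ::
  "('m::graded_magma \<Rightarrow> ('n::graded_magma, 'k::comm_ring_1) series) \<Rightarrow> bool" where
  "degree_raising \<phi> \<longleftrightarrow> (\<forall>m w. mdeg w < mdeg m \<longrightarrow> scoeff (\<phi> m) w = 0)"

text \<open>The restrictions to the magma of the continuous unital algebra homomorphisms that do not lower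
  degrees.\<close>

definition series_rep ::
  "('m::graded_magma \<Rightarrow> ('n::graded_magma, 'k::comm_ring_1) series) \<Rightarrow> bool" where
  "series_rep \<phi> \<longleftrightarrow> degree_raising \<phi> \<and> \<phi> 1 = 1 \<and> (\<forall>a b. \<phi> (a * b) = \<phi> a * \<phi> b)"

lemma degree_raisingD: "degree_raising \<phi> \<Longrightarrow> mdeg w < mdeg m \<Longrightarrow> scoeff (\<phi> m) w = 0"
  by (simp add: degree_raising_def)

lemma series_rep_degree_raising: "series_rep \<phi> \<Longrightarrow> degree_raising \<phi>"
  by (simp add: series_rep_def)

text \<open>The cut-off \<open>N\<close> is left free so that coefficients at words of different degrees can be
  expressed as sums over the same finite set.\<close>

lemma scoeff_lin_ext_graded:
  assumes "degree_raising \<phi>" "mdeg w \<le> N"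
  shows "scoeff (lin_ext \<phi> f) w = (\<Sum>m | mdeg m \<le> N. scoeff f m * scoeff (\<phi> m) w)"
proof -
  have "scoeff (lin_ext \<phi> f) w = Sum_any (\<lambda>m. scoeff f m * scoeff (\<phi> m) w)"
    by (simp add: lin_ext_def Abs_series_inverse)
  also have "\<dots> = (\<Sum>m | mdeg m \<le> N. scoeff f m * scoeff (\<phi> m) w)"
  proof (rule Sum_any.expand_superset [OF finite_mdeg], clarify)
    fix m assume "scoeff f m * scoeff (\<phi> m) w \<noteq> 0"
    then have "scoeff (\<phi> m) w \<noteq> 0" by (metis mult_zero_right)
    then show "mdeg m \<le> N"
      using assms unfolding degree_raising_def by (meson le_trans not_le)
  qed
  finally show ?thesis .
qed

lemma lin_ext_diff:
  "degree_raising \<phi> \<Longrightarrow> lin_ext \<phi> (f - g) = lin_ext \<phi> f - lin_ext \<phi> g"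
  by (rule series_eqI)
    (simp add: scoeff_lin_ext_graded [OF _ order_refl] algebra_simps sum_subtractf)

lemma lin_ext_add:
  "degree_raising \<phi> \<Longrightarrow> lin_ext \<phi> (f + g) = lin_ext \<phi> f + lin_ext \<phi> g"
  by (rule series_eqI)
    (simp add: scoeff_lin_ext_graded [OF _ order_refl] algebra_simps sum.distrib)

lemma lin_ext_on_mono:
  assumes "degree_raising \<phi>"
  shows "lin_ext \<phi> (series_mono m) = \<phi> m"
proof (rule series_eqI)
  fix w
  have "scoeff (lin_ext \<phi> (series_mono m)) w =
      (\<Sum>m' | mdeg m' \<le> mdeg w + mdeg m. scoeff (series_mono m) m' * scoeff (\<phi> m') w)"
    by (rule scoeff_lin_ext_graded [OF assms]) simp
  also have "\<dots> = (\<Sum>m' \<in> {m}. scoeff (series_mono m) m' * scoeff (\<phi> m') w)"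
    by (rule sum.mono_neutral_right) (auto simp: finite_mdeg)
  finally show "scoeff (lin_ext \<phi> (series_mono m)) w = scoeff (\<phi> m) w" by simp
qed

lemma lin_ext_one: "series_rep \<phi> \<Longrightarrow> lin_ext \<phi> 1 = 1"
  using lin_ext_on_mono [of \<phi> 1] by (simp add: series_rep_def one_series_def)

text \<open>Up to the degree of \<open>w\<close> everything is a finite sum. Both coefficients at \<open>w\<close> equal the sum of
  $f_a g_b \varphi(ab)_w$ over all pairs $(a, b)$ of degrees at most that of \<open>w\<close>: for the left-hand side
  the pairs are grouped by their product, the pairs whose product has larger degree contributing
  nothing; for the right-hand side $\varphi(ab) = \varphi(a)\varphi(b)$ is expanded.\<close>

lemma lin_ext_mult:
  fixes \<phi> :: "'m::graded_magma \<Rightarrow> ('n::graded_magma, 'k::comm_ring_1) series"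
  assumes "series_rep \<phi>"
  shows "lin_ext \<phi> (f * g) = lin_ext \<phi> f * lin_ext \<phi> g"
proof (rule series_eqI)
  fix w :: 'n
  have dr: "degree_raising \<phi>" and mult: "\<phi> (a * b) = \<phi> a * \<phi> b" for a b
    using assms by (auto simp: series_rep_def)
  let ?S = "{m :: 'm. mdeg m \<le> mdeg w}" and ?F = "{(u, v). u * v = w}"
  let ?h = "\<lambda>p. scoeff f (fst p) * scoeff g (snd p) * scoeff (\<phi> (fst p * snd p)) w"
  let ?P = "{p \<in> ?S \<times> ?S. fst p * snd p \<in> ?S}"
  have fin: "finite (?S \<times> ?S)" by (intro finite_cartesian_product finite_mdeg)
  have "scoeff (lin_ext \<phi> (f * g)) w = (\<Sum>m\<in>?S. scoeff (f * g) m * scoeff (\<phi> m) w)"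
    by (rule scoeff_lin_ext_graded [OF dr order_refl])
  also have "\<dots> = (\<Sum>m\<in>?S. sum ?h {p \<in> ?P. fst p * snd p = m})"
    unfolding scoeff_mult sum_distrib_right
    by (intro sum.cong refl) (auto simp: mdeg_mult algebra_simps)
  also have "\<dots> = sum ?h ?P"
    by (rule sum.group) (use fin finite_mdeg in auto)
  also have "\<dots> = sum ?h (?S \<times> ?S)"
  proof (rule sum.mono_neutral_left [OF fin])
    show "\<forall>p \<in> ?S \<times> ?S - ?P. ?h p = 0"
      using degree_raisingD [OF dr] by (auto simp: not_le)
  qed auto
  finally have 1: "scoeff (lin_ext \<phi> (f * g)) w = sum ?h (?S \<times> ?S)" .
  have "scoeff (lin_ext \<phi> f * lin_ext \<phi> g) w = (\<Sum>(u, v) \<in> ?F.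
      (\<Sum>a\<in>?S. scoeff f a * scoeff (\<phi> a) u) * (\<Sum>b\<in>?S. scoeff g b * scoeff (\<phi> b) v))"
    unfolding scoeff_mult
  proof (rule sum.cong [OF refl])
    fix q assume "q \<in> ?F"
    then have "mdeg (fst q) \<le> mdeg w" "mdeg (snd q) \<le> mdeg w" by (auto simp: mdeg_mult)
    then show "(case q of (u, v) \<Rightarrow> scoeff (lin_ext \<phi> f) u * scoeff (lin_ext \<phi> g) v) =
        (case q of (u, v) \<Rightarrow>
          (\<Sum>a\<in>?S. scoeff f a * scoeff (\<phi> a) u) * (\<Sum>b\<in>?S. scoeff g b * scoeff (\<phi> b) v))"
      by (simp add: case_prod_unfold scoeff_lin_ext_graded [OF dr])
  qed
  also have "\<dots> = (\<Sum>q\<in>?F. \<Sum>p\<in>?S \<times> ?S. scoeff f (fst p) * scoeff g (snd p) *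
      (scoeff (\<phi> (fst p)) (fst q) * scoeff (\<phi> (snd p)) (snd q)))"
    by (simp add: case_prod_unfold sum_product sum.cartesian_product algebra_simps)
  also have "\<dots> = sum ?h (?S \<times> ?S)"
    by (subst sum.swap) (simp add: mult scoeff_mult case_prod_unfold sum_distrib_left)
  finally show "scoeff (lin_ext \<phi> (f * g)) w = scoeff (lin_ext \<phi> f * lin_ext \<phi> g) w"
    using 1 by simp
qed

text \<open>Linear extensions compose, because the sums in each coefficient can be interchanged.\<close>

lemma lin_ext_lin_ext:
  fixes \<phi> :: "'l::graded_magma \<Rightarrow> ('m::graded_magma, 'k::comm_ring_1) series"
    and \<psi> :: "'m \<Rightarrow> ('n::graded_magma, 'k) series"
  assumes \<phi>: "degree_raising \<phi>" and \<psi>: "degree_raising \<psi>"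
    and \<psi>\<phi>: "degree_raising (\<lambda>m. lin_ext \<psi> (\<phi> m))"
  shows "lin_ext \<psi> (lin_ext \<phi> f) = lin_ext (\<lambda>m. lin_ext \<psi> (\<phi> m)) f"
proof (rule series_eqI)
  fix w :: 'n
  let ?S = "{l :: 'l. mdeg l \<le> mdeg w}" and ?T = "{m :: 'm. mdeg m \<le> mdeg w}"
  have "scoeff (lin_ext \<psi> (lin_ext \<phi> f)) w =
      (\<Sum>m\<in>?T. \<Sum>l\<in>?S. scoeff f l * (scoeff (\<phi> l) m * scoeff (\<psi> m) w))"
    unfolding scoeff_lin_ext_graded [OF \<psi> order_refl]
    by (rule sum.cong [OF refl])
      (simp add: scoeff_lin_ext_graded [OF \<phi>, of _ "mdeg w"] sum_distrib_right mult.assoc)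
  also have "\<dots> = (\<Sum>l\<in>?S. \<Sum>m\<in>?T. scoeff f l * (scoeff (\<phi> l) m * scoeff (\<psi> m) w))"
    by (rule sum.swap)
  also have "\<dots> = scoeff (lin_ext (\<lambda>m. lin_ext \<psi> (\<phi> m)) f) w"
    unfolding scoeff_lin_ext_graded [OF \<psi>\<phi> order_refl]
    by (simp add: scoeff_lin_ext_graded [OF \<psi> order_refl] sum_distrib_left)
  finally show "scoeff (lin_ext \<psi> (lin_ext \<phi> f)) w = scoeff (lin_ext (\<lambda>m. lin_ext \<psi> (\<phi> m)) f) w" .
qed

text \<open>A word with \<open>n\<close> leaves is evaluated to a product of \<open>n\<close> series without constant term, which
  has no terms of degree below \<open>n\<close>.\<close>

lemma degree_raising_mag_eval:
  fixes g :: "'x \<Rightarrow> ('n::graded_magma, 'k::comm_ring_1) series"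
  assumes "\<And>x. scoeff (g x) 1 = 0"
  shows "mdeg w < leaves u \<Longrightarrow> scoeff (mag_eval g u) w = 0"
proof (induction u arbitrary: w)
  case (Leaf x)
  then show ?case using assms mdeg_eq_0 [of w] by simp
next
  case (Node u v)
  have "scoeff (mag_eval g u) a * scoeff (mag_eval g v) b = 0" if "a * b = w" for a b
    using Node mdeg_mult [of a b] that by (cases "mdeg a < leaves u") auto
  then show ?case by (auto simp: scoeff_mult intro!: sum.neutral)
qed

lemma series_rep_umag_eval:
  fixes g :: "'x::finite \<Rightarrow> ('n::graded_magma, 'k::comm_ring_1) series"
  assumes "\<And>x. scoeff (g x) 1 = 0"
  shows "series_rep (umag_eval g)"
  unfolding series_rep_def degree_raising_def
proof (intro conjI allI impI)
  show "scoeff (umag_eval g m) w = 0" if "mdeg w < mdeg m" for m w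
    using that degree_raising_mag_eval [OF assms] by (cases m) (auto simp: mdeg_umag_def)
  show "umag_eval g 1 = 1"
    by (simp add: one_umag_def)
  show "umag_eval g (a * b) = umag_eval g a * umag_eval g b" for a b
    by (simp add: umag_eval_mult)
qed

lemma lin_ext_var:
  fixes g :: "'x::finite \<Rightarrow> ('n::graded_magma, 'k::comm_ring_1) series"
  assumes "\<And>x. scoeff (g x) 1 = 0"
  shows "lin_ext (umag_eval g) (series_var x) = g x"
proof -
  have "series_rep (umag_eval g)" by (rule series_rep_umag_eval) (rule assms)
  then show ?thesis
    using lin_ext_on_mono [of "umag_eval g" "Word (Leaf x)"]
    by (simp add: series_var_def series_rep_degree_raising)
qed

lemma lin_ext_constant_term:
  fixes \<phi> :: "'m::graded_magma \<Rightarrow> ('n::graded_magma, 'k::comm_ring_1) series"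
  assumes "series_rep \<phi>"
  shows "scoeff (lin_ext \<phi> f) 1 = scoeff f 1"
proof -
  have "{m :: 'm. mdeg m \<le> 0} = {1}" by (auto simp: mdeg_eq_0)
  then show ?thesis using assms
    by (simp add: scoeff_lin_ext_graded [of _ _ 0] series_rep_def scoeff_one)
qed

text \<open>A continuous homomorphism commutes with substitution: both sides are continuous homomorphisms in
  \<open>f\<close> with the same values on the variables. This one rule gives $\Delta(f(h)) = f(\Delta(h))$,
  the passage from one variable to an arbitrary series, and the associativity of composition.\<close>

lemma lin_ext_subst:
  fixes g :: "'x::finite \<Rightarrow> ('m::graded_magma, 'k::comm_ring_1) series"
    and \<psi> :: "'m \<Rightarrow> ('n::graded_magma, 'k) series"
  assumes g: "\<And>x. scoeff (g x) 1 = 0" and \<psi>: "series_rep \<psi>"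
  shows "lin_ext \<psi> (lin_ext (umag_eval g) f) = lin_ext (umag_eval (\<lambda>x. lin_ext \<psi> (g x))) f"
proof -
  have "lin_ext \<psi> (mag_eval g u) = mag_eval (\<lambda>x. lin_ext \<psi> (g x)) u" for u
    by (induction u) (simp_all add: lin_ext_mult \<psi>)
  then have "lin_ext \<psi> (umag_eval g m) = umag_eval (\<lambda>x. lin_ext \<psi> (g x)) m" for m
    by (cases m) (simp_all add: lin_ext_one \<psi>)
  then show ?thesis
    using lin_ext_lin_ext [of "umag_eval g" \<psi> f]
    by (simp add: series_rep_degree_raising series_rep_umag_eval lin_ext_constant_term g \<psi>)
qed


section \<open>Tensors of series\<close>

definition series_tensor ::
  "('m, 'k) series \<Rightarrow> ('n, 'k::comm_ring_1) series \<Rightarrow> ('m \<times> 'n, 'k) series"  (infixl "\<otimes>\<^sub>s" 75)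
  where "f \<otimes>\<^sub>s g = Abs_series (\<lambda>(a, b). scoeff f a * scoeff g b)"

lemma scoeff_tensor [simp]: "scoeff (f \<otimes>\<^sub>s g) p = scoeff f (fst p) * scoeff g (snd p)"
  by (simp add: series_tensor_def Abs_series_inverse case_prod_unfold)

lemma series_tensor_one [simp]: "1 \<otimes>\<^sub>s 1 = (1 :: ('m::unital_magma \<times> 'n::unital_magma, 'k::comm_ring_1) series)"
proof (rule series_eqI)
  show "scoeff (1 \<otimes>\<^sub>s 1) p = scoeff (1 :: ('m \<times> 'n, 'k) series) p" for p
    by (cases p) (simp add: scoeff_one one_prod_def)
qed

lemma series_tensor_mult:
  fixes f f' :: "('m::unital_magma, 'k::comm_ring_1) series" and g g' :: "('n::unital_magma, 'k) series"
  shows "(f \<otimes>\<^sub>s g) * (f' \<otimes>\<^sub>s g') = (f * f') \<otimes>\<^sub>s (g * g')"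
proof (rule series_eqI)
  fix w :: "'m \<times> 'n"
  obtain u v where w: "w = (u, v)" by (cases w)
  have "scoeff ((f \<otimes>\<^sub>s g) * (f' \<otimes>\<^sub>s g')) w =
     (\<Sum>z \<in> {(a, a'). a * a' = u} \<times> {(b, b'). b * b' = v}.
        (scoeff f (fst (fst z)) * scoeff f' (snd (fst z))) *
        (scoeff g (fst (snd z)) * scoeff g' (snd (snd z))))"
    unfolding scoeff_mult w
    by (rule sum.reindex_bij_witness
        [of _ "\<lambda>((a, a'), (b, b')). ((a, b), (a', b'))" "\<lambda>((a, b), (a', b')). ((a, a'), (b, b'))"])
      (auto simp: times_prod_def algebra_simps)
  also have "\<dots> = scoeff ((f * f') \<otimes>\<^sub>s (g * g')) w"
    by (simp add: w scoeff_mult sum_product sum.cartesian_product case_prod_unfold)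
  finally show "scoeff ((f \<otimes>\<^sub>s g) * (f' \<otimes>\<^sub>s g')) w = scoeff ((f * f') \<otimes>\<^sub>s (g * g')) w" .
qed

text \<open>Extends to the map $f \otimes g \mapsto \varphi(f) \otimes \psi(g)$, see \<open>lin_ext_tensor\<close>.\<close>

definition rep_tensor where
  "rep_tensor \<phi> \<psi> = (\<lambda>(a, b). \<phi> a \<otimes>\<^sub>s \<psi> b)"

lemma series_rep_tensor:
  fixes \<phi> :: "'a::graded_magma \<Rightarrow> ('m::graded_magma, 'k::comm_ring_1) series"
    and \<psi> :: "'b::graded_magma \<Rightarrow> ('n::graded_magma, 'k) series"
  assumes \<phi>: "series_rep \<phi>" and \<psi>: "series_rep \<psi>"
  shows "series_rep (rep_tensor \<phi> \<psi>)"
  unfolding series_rep_def [of "rep_tensor \<phi> \<psi>"] degree_raising_def [of "rep_tensor \<phi> \<psi>"]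
proof (intro conjI allI impI)
  fix p :: "'a \<times> 'b" and q :: "'m \<times> 'n" assume "mdeg q < mdeg p"
  then have "mdeg (fst q) < mdeg (fst p) \<or> mdeg (snd q) < mdeg (snd p)"
    by (auto simp: mdeg_prod_def)
  then show "scoeff (rep_tensor \<phi> \<psi> p) q = 0"
    using assms by (cases p; cases q) (auto simp: rep_tensor_def series_rep_def degree_raising_def)
next
  show "rep_tensor \<phi> \<psi> 1 = 1"
    using assms by (simp add: rep_tensor_def one_prod_def series_rep_def)
  show "rep_tensor \<phi> \<psi> (p * q) = rep_tensor \<phi> \<psi> p * rep_tensor \<phi> \<psi> q" for p q
    using assms by (simp add: rep_tensor_def times_prod_def series_rep_def series_tensor_mult
      case_prod_unfold)
qed

lemma lin_ext_tensor:
  fixes \<phi> :: "'a::graded_magma \<Rightarrow> ('m::graded_magma, 'k::comm_ring_1) series"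
    and \<psi> :: "'b::graded_magma \<Rightarrow> ('n::graded_magma, 'k) series"
  assumes \<phi>: "series_rep \<phi>" and \<psi>: "series_rep \<psi>"
  shows "lin_ext (rep_tensor \<phi> \<psi>) (f \<otimes>\<^sub>s g) = lin_ext \<phi> f \<otimes>\<^sub>s lin_ext \<psi> g"
proof (rule series_eqI)
  fix w :: "'m \<times> 'n"
  obtain u v where w: "w = (u, v)" by (cases w)
  let ?N = "mdeg u + mdeg v"
  let ?A = "{a :: 'a. mdeg a \<le> ?N}" and ?B = "{b :: 'b. mdeg b \<le> ?N}"
  let ?h = "\<lambda>p. scoeff (f \<otimes>\<^sub>s g) p * scoeff (rep_tensor \<phi> \<psi> p) w"
  have zero: "?h p = 0" if "\<not> mdeg p \<le> ?N" for p
  proof -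
    have "mdeg w < mdeg p" using that by (simp add: w mdeg_prod_def)
    then show ?thesis
      using degree_raisingD [OF series_rep_degree_raising [OF series_rep_tensor [OF assms]]] by simp
  qed
  have "scoeff (lin_ext (rep_tensor \<phi> \<psi>) (f \<otimes>\<^sub>s g)) w = (\<Sum>p | mdeg p \<le> ?N. ?h p)"
    by (rule scoeff_lin_ext_graded [OF series_rep_degree_raising [OF series_rep_tensor [OF assms]]])
      (simp add: w mdeg_prod_def)
  also have "\<dots> = sum ?h (?A \<times> ?B)"
  proof (rule sum.mono_neutral_left)
    show "\<forall>p \<in> ?A \<times> ?B - {p. mdeg p \<le> ?N}. ?h p = 0" using zero by blast
  qed (auto simp: finite_mdeg mdeg_prod_def)
  also have "\<dots> = (\<Sum>a\<in>?A. scoeff f a * scoeff (\<phi> a) u) * (\<Sum>b\<in>?B. scoeff g b * scoeff (\<psi> b) v)"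
    by (simp add: sum_product sum.cartesian_product case_prod_unfold w rep_tensor_def algebra_simps)
  also have "\<dots> = scoeff (lin_ext \<phi> f \<otimes>\<^sub>s lin_ext \<psi> g) w"
    using assms by (simp add: w scoeff_lin_ext_graded [of _ _ ?N] series_rep_def)
  finally show "scoeff (lin_ext (rep_tensor \<phi> \<psi>) (f \<otimes>\<^sub>s g)) w = scoeff (lin_ext \<phi> f \<otimes>\<^sub>s lin_ext \<psi> g) w" .
qed

section \<open>The co-addition of series\<close>

definition primitive_tensor ::
  "('m::unital_magma, 'k::comm_ring_1) series \<Rightarrow> ('m \<times> 'm, 'k) series" where
  "primitive_tensor h = h \<otimes>\<^sub>s 1 + 1 \<otimes>\<^sub>s h"

definition series_coaddition ::
  "('x::finite umag, 'k::comm_ring_1) series \<Rightarrow> ('x umag \<times> 'x umag, 'k) series" where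
  "series_coaddition = lin_ext (umag_eval (\<lambda>x. primitive_tensor (series_var x)))"

text \<open>Composition $f(t)$ for a series \<open>t\<close> over any graded magma; it is needed for \<open>t\<close> in the tensor
  square, which is not a free algebra.\<close>

abbreviation series_at ::
  "(unit umag, 'k::comm_ring_1) series \<Rightarrow> ('n::graded_magma, 'k) series \<Rightarrow> ('n, 'k) series" where
  "series_at f t \<equiv> lin_ext (umag_eval (\<lambda>_. t)) f"

lemma primitive_tensor_constant_term:
  "scoeff h 1 = 0 \<Longrightarrow> scoeff (primitive_tensor h) 1 = 0"
  by (simp add: primitive_tensor_def one_prod_def)

lemma series_var_constant_term: "scoeff (series_var x :: ('x umag, 'k::comm_ring_1) series) 1 = 0"
  by (simp add: series_var_def one_umag_def)

lemmas constant_terms = primitive_tensor_constant_term series_var_constant_term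

lemma series_rep_coaddition:
  "series_rep (umag_eval (\<lambda>x::'x::finite. primitive_tensor (series_var x) :: (_, 'k::comm_ring_1) series))"
  by (rule series_rep_umag_eval) (simp add: constant_terms)

lemma series_coaddition_mult:
  "series_coaddition (f * g) = series_coaddition f * series_coaddition g"
  unfolding series_coaddition_def by (rule lin_ext_mult [OF series_rep_coaddition])

lemma series_coaddition_var: "series_coaddition (series_var x) = primitive_tensor (series_var x)"
  unfolding series_coaddition_def by (rule lin_ext_var) (simp add: constant_terms)

lemma series_coaddition_constant_term: "scoeff (series_coaddition f) 1 = scoeff f 1"
  unfolding series_coaddition_def by (rule lin_ext_constant_term [OF series_rep_coaddition])

lemma series_coaddition_comp:
  assumes "scoeff h 1 = 0"
  shows "series_coaddition (series_comp f h) = series_at f (series_coaddition h)"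
  unfolding series_coaddition_def series_comp_def
  by (rule lin_ext_subst) (simp_all add: assms series_rep_coaddition)

text \<open>Substituting homogeneous elements of degree \<open>1\<close> for the letters preserves the degree of words.\<close>

lemma mag_eval_homogeneous:
  fixes g :: "'x \<Rightarrow> ('n::graded_magma, 'k::comm_ring_1) series"
  assumes "\<And>x w. mdeg w \<noteq> 1 \<Longrightarrow> scoeff (g x) w = 0"
  shows "mdeg w \<noteq> leaves u \<Longrightarrow> scoeff (mag_eval g u) w = 0"
proof (induction u arbitrary: w)
  case (Leaf x)
  then show ?case using assms by simp
next
  case (Node u v)
  have "scoeff (mag_eval g u) a * scoeff (mag_eval g v) b = 0" if "a * b = w" for a b
    using Node mdeg_mult [of a b] that by (cases "mdeg a = leaves u") auto
  then show ?case by (auto simp: scoeff_mult intro!: sum.neutral)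
qed

lemma coaddition_homogeneous:
  fixes w :: "'x::finite umag \<times> 'x umag"
  assumes "mdeg w \<noteq> deg m"
  shows "scoeff (umag_eval (\<lambda>x. primitive_tensor (series_var x)) m) w = (0 :: 'k::comm_ring_1)"
proof (cases m)
  case Empty
  then show ?thesis using assms by (auto simp: scoeff_one)
next
  case (Word u)
  have "scoeff (primitive_tensor (series_var x)) w = (0 :: 'k)"
    if "mdeg w \<noteq> 1" for x and w :: "'x umag \<times> 'x umag"
    using that by (cases w)
      (auto simp: primitive_tensor_def series_var_def scoeff_one mdeg_prod_def one_umag_def mdeg_umag_def)
  from mag_eval_homogeneous [OF this] show ?thesis
    using Word assms by simp
qed


section \<open>The exponential is group-like\<close>

text \<open>In the coefficient of $f f$ at \<open>w\<close>, the two trivial factorizations of \<open>w\<close> contribute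
  \<open>2 * scoeff f w\<close> and the others only involve coefficients of smaller degree. So the
  doubling equation determines \<open>(2 ^ mdeg w - 2) * scoeff f w\<close> by recursion, and the factor is
  non-zero in degrees at least \<open>2\<close>.\<close>

lemma doubling_unique:
  fixes f g :: "('m::graded_magma, 'k::field_char_0) series"
  assumes f: "\<And>w. scoeff (f * f) w = 2 ^ mdeg w * scoeff f w" "scoeff f 1 = 1"
    and g: "\<And>w. scoeff (g * g) w = 2 ^ mdeg w * scoeff g w" "scoeff g 1 = 1"
    and one: "\<And>w. mdeg w = 1 \<Longrightarrow> scoeff f w = scoeff g w"
  shows "f = g"
proof (rule series_eqI)
  fix w
  show "scoeff f w = scoeff g w"
  proof (induction "mdeg w" arbitrary: w rule: less_induct)
    case less
    show ?case
    proof (cases "mdeg w \<le> 1")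
      case True
      then show ?thesis using f(2) g(2) one mdeg_eq_0 [of w] by (cases "mdeg w = 1") auto
    next
      case False
      then have w: "w \<noteq> 1" by auto
      define F where "F = {(a, b). a * b = w} - {(1, w), (w, 1)}"
      have split: "scoeff (h * h) w = 2 * scoeff h w + (\<Sum>(a, b)\<in>F. scoeff h a * scoeff h b)"
        if "scoeff h 1 = 1" for h :: "('m, 'k) series"
      proof -
        have "{(a, b). a * b = w} = insert (1, w) (insert (w, 1) F)" by (auto simp: F_def)
        moreover have "finite F" by (simp add: F_def finite_factorizations)
        moreover have "(1, w) \<notin> insert (w, 1) F" "(w, 1) \<notin> F" using w by (auto simp: F_def)
        ultimately show ?thesis by (simp add: scoeff_mult that)
      qed
      have "scoeff f a * scoeff f b = scoeff g a * scoeff g b" if "(a, b) \<in> F" for a b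
      proof -
        have "a * b = w" "a \<noteq> 1" "b \<noteq> 1" using that by (auto simp: F_def)
        then have "mdeg a < mdeg w" "mdeg b < mdeg w"
          using mdeg_eq_0 [of a] mdeg_eq_0 [of b] by (auto simp: mdeg_mult)
        then show ?thesis using less by simp
      qed
      then have "(\<Sum>(a, b)\<in>F. scoeff f a * scoeff f b) = (\<Sum>(a, b)\<in>F. scoeff g a * scoeff g b)"
        by (intro sum.cong) auto
      then have "(2 ^ mdeg w - 2) * scoeff f w = (2 ^ mdeg w - 2) * scoeff g w"
        using split [OF f(2)] split [OF g(2)] f(1) [of w] g(1) [of w] by (simp add: algebra_simps)
      moreover have "(2 :: 'k) ^ mdeg w - 2 \<noteq> 0"
      proof -
        have "(2::nat) ^ mdeg w \<noteq> 2 ^ 1"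
          using False by (subst power_inject_exp) auto
        then have "of_nat (2 ^ mdeg w) \<noteq> (of_nat (2 ^ 1) :: 'k)" unfolding of_nat_eq_iff .
        then show ?thesis by simp
      qed
      ultimately show ?thesis by simp
    qed
  qed
qed

lemma nexp_props:
  "scoeff (nexp :: (unit umag, 'k::field_char_0) series) 1 = 1"
  "scoeff (nexp :: (unit umag, 'k) series) (Word (Leaf ())) = 1"
  "scoeff (nexp * nexp :: (unit umag, 'k) series) w = 2 ^ deg w * scoeff nexp w"
  using is_nexp_nexp [where 'k = 'k] scoeff_deriv_1 [of "nexp :: (unit umag, 'k) series"]
  by (simp_all add: is_nexp_def scoeff_comp_smul)

lemma unit_umag_deg_le_1:
  fixes m :: "unit umag"
  shows "deg m \<le> 1 \<longleftrightarrow> m = 1 \<or> m = Word (Leaf ())"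
proof
  assume m: "deg m \<le> 1"
  show "m = 1 \<or> m = Word (Leaf ())"
  proof (cases m)
    case (Word u)
    show ?thesis
    proof (cases u)
      case (Node a b)
      then show ?thesis using m Word leaves_pos [of a] leaves_pos [of b] by simp
    qed (simp add: Word)
  qed (simp add: one_umag_def)
qed (auto simp: one_umag_def)

text \<open>Both sides satisfy the doubling equation: \<open>\<Delta>\<close> preserves products and degrees, and the tensor
  product of series is multiplicative and adds degrees.\<close>

lemma series_coaddition_nexp:
  "series_coaddition nexp = nexp \<otimes>\<^sub>s (nexp :: (unit umag, 'k::field_char_0) series)"
proof (rule doubling_unique)
  let ?e = "nexp :: (unit umag, 'k) series"
  let ?\<Delta> = "umag_eval (\<lambda>x. primitive_tensor (series_var x)) :: unit umag \<Rightarrow> (unit umag \<times> unit umag, 'k) series"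
  note coeff = scoeff_lin_ext_graded [OF series_rep_degree_raising [OF series_rep_coaddition], folded series_coaddition_def]
  fix w :: "unit umag \<times> unit umag"
  obtain a b where w: "w = (a, b)" by (cases w)
  show "scoeff (series_coaddition ?e * series_coaddition ?e) w = 2 ^ mdeg w * scoeff (series_coaddition ?e) w"
  proof -
    have *: "scoeff (?e * ?e) m * scoeff (?\<Delta> m) w = 2 ^ mdeg w * (scoeff ?e m * scoeff (?\<Delta> m) w)" for m
      using coaddition_homogeneous [of w m, where 'k = 'k] by (cases "mdeg w = deg m") (simp_all add: nexp_props)
    show ?thesis
      unfolding series_coaddition_mult [symmetric] coeff [OF order_refl] sum_distrib_left
      by (intro sum.cong refl *)
  qed
  show "scoeff ((?e \<otimes>\<^sub>s ?e) * (?e \<otimes>\<^sub>s ?e)) w = 2 ^ mdeg w * scoeff (?e \<otimes>\<^sub>s ?e) w"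
    by (simp add: series_tensor_mult w nexp_props mdeg_prod_def mdeg_umag_def power_add algebra_simps)
  show "scoeff (series_coaddition ?e) w = scoeff (?e \<otimes>\<^sub>s ?e) w" if w1: "mdeg w = 1"
  proof -
    have x: "m = Word (Leaf ())" if "deg m = 1" for m :: "unit umag"
      using that unit_umag_deg_le_1 [of m] by (auto simp: one_umag_def)
    from w1 have "deg a = 0 \<and> deg b = 1 \<or> deg a = 1 \<and> deg b = 0"
      by (auto simp: w mdeg_prod_def mdeg_umag_def)
    then have ab: "a = 1 \<and> b = Word (Leaf ()) \<or> a = Word (Leaf ()) \<and> b = 1"
      using x by (auto simp: deg_eq_0)
    have "scoeff (series_coaddition ?e) w = (\<Sum>m\<in>{1, Word (Leaf ())}. scoeff ?e m * scoeff (?\<Delta> m) w)"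
    proof -
      have "{m :: unit umag. mdeg m \<le> 1} = {1, Word (Leaf ())}"
        unfolding mdeg_umag_def unit_umag_deg_le_1 by auto
      then show ?thesis using coeff [of w 1 ?e] w1 by simp
    qed
    also have "\<dots> = 1"
      using ab by (auto simp: w one_umag_def nexp_props [unfolded one_umag_def] scoeff_one one_prod_def
        primitive_tensor_def series_var_def)
    also have "\<dots> = scoeff (?e \<otimes>\<^sub>s ?e) w"
      using ab by (auto simp: w nexp_props)
    finally show ?thesis .
  qed
next
  show "scoeff (series_coaddition nexp) 1 = (1 :: 'k)"
    by (simp add: series_coaddition_constant_term nexp_props)
  show "scoeff (nexp \<otimes>\<^sub>s nexp) 1 = (1 :: 'k)"
    by (simp add: one_prod_def nexp_props)
qed

text \<open>The doubling equation cannot be used directly here, since \<open>h\<close> need not be homogeneous. Instead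
  the one-variable case is mapped by $f \otimes g \mapsto f(h) \otimes g(h)$.\<close>

lemma nexp_primitive_tensor:
  fixes h :: "('x::finite umag, 'k::field_char_0) series"
  assumes h: "scoeff h 1 = 0"
  shows "series_at nexp (primitive_tensor h) = series_comp nexp h \<otimes>\<^sub>s series_comp nexp h"
proof -
  let ?h = "umag_eval (\<lambda>_::unit. h)"
  let ?\<psi> = "rep_tensor ?h ?h"
  have rep: "series_rep ?h" using h by (intro series_rep_umag_eval)
  note \<psi> = series_rep_tensor [OF rep rep]
  have "lin_ext ?h ivar = h" using lin_ext_var [of "\<lambda>_. h"] h by simp
  then have "lin_ext ?\<psi> (primitive_tensor ivar) = primitive_tensor h"
    by (simp add: primitive_tensor_def lin_ext_add series_rep_degree_raising \<psi>
      lin_ext_tensor [OF rep rep] lin_ext_one rep)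
  then have "series_at nexp (primitive_tensor h) = lin_ext ?\<psi> (series_coaddition nexp)"
    unfolding series_coaddition_def
    by (subst lin_ext_subst) (simp_all add: \<psi> constant_terms)
  also have "\<dots> = series_comp nexp h \<otimes>\<^sub>s series_comp nexp h"
    by (simp add: series_coaddition_nexp lin_ext_tensor [OF rep rep] series_comp_def)
  finally show ?thesis .
qed

text \<open>The logarithm recovers the argument: $\log(1 + (\exp(r) - 1)) = r$ follows from the identity of
  series in one variable by substituting \<open>r\<close>.\<close>

lemma series_at_nexp_inject:
  fixes s t :: "('n::graded_magma, 'k::field_char_0) series"
  assumes s: "scoeff s 1 = 0" and t: "scoeff t 1 = 0"
    and eq: "series_at nexp s = series_at nexp t"
  shows "s = t"
proof -
  have log: "series_at nlog1p (series_at nexp r - 1) = r"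
    if r: "scoeff r 1 = 0" for r :: "('n, 'k) series"
  proof -
    have rep: "series_rep (umag_eval (\<lambda>_::unit. r))" using r by (intro series_rep_umag_eval)
    have "r = series_at ivar r"
      by (rule lin_ext_var [of "\<lambda>_. r", symmetric]) (rule r)
    also have "ivar = series_comp nlog1p (nexp - 1 :: (unit umag, 'k) series)"
      using is_nlog1p_nlog1p [where 'k = 'k] by (simp add: is_nlog1p_def)
    also have "series_at \<dots> r = series_at nlog1p (series_at (nexp - 1) r)"
      unfolding series_comp_def by (rule lin_ext_subst) (simp_all add: rep nexp_props scoeff_one)
    also have "series_at (nexp - 1) r = series_at nexp r - 1"
      by (simp add: lin_ext_diff lin_ext_one rep series_rep_degree_raising)
    finally show ?thesis by (rule sym)
  qed
  have "s = series_at nlog1p (series_at nexp s - 1)"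
    by (rule log [OF s, symmetric])
  also have "\<dots> = t" unfolding eq by (rule log [OF t])
  finally show ?thesis .
qed


section \<open>The Hausdorff series is primitive\<close>

text \<open>Both sides have the exponential $\exp(H) \otimes \exp(H)$: the left one because $\exp(H)$ is the
  product of the group-like series $\exp(x)$ and $\exp(y)$, the right one by
  \<open>nexp_primitive_tensor\<close>.\<close>

lemma series_coaddition_hausdorff:
  "series_coaddition hausdorff = primitive_tensor (hausdorff :: (xy umag, 'k::field_char_0) series)"
proof (rule series_at_nexp_inject)
  let ?H = "hausdorff :: (xy umag, 'k) series"
  let ?x = "series_comp nexp (series_var Var_x) :: (xy umag, 'k) series"
  let ?y = "series_comp nexp (series_var Var_y) :: (xy umag, 'k) series"
  have H: "scoeff ?H 1 = 0" "series_comp nexp ?H = ?x * ?y"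
    using hausdorff_iff [of ?H] by auto
  show "scoeff (series_coaddition ?H) 1 = 0" "scoeff (primitive_tensor ?H) 1 = 0"
    by (simp_all add: H series_coaddition_constant_term constant_terms)
  have var: "series_coaddition (series_comp nexp (series_var v)) =
      series_comp nexp (series_var v) \<otimes>\<^sub>s (series_comp nexp (series_var v) :: (xy umag, 'k) series)" for v
    by (simp add: series_coaddition_comp constant_terms series_coaddition_var nexp_primitive_tensor)
  have "series_at nexp (series_coaddition ?H) = series_coaddition ?x * series_coaddition ?y"
    by (simp add: series_coaddition_comp [symmetric] H series_coaddition_mult)
  also have "\<dots> = (?x * ?y) \<otimes>\<^sub>s (?x * ?y)" by (simp add: var series_tensor_mult)
  also have "\<dots> = series_at nexp (primitive_tensor ?H)" by (simp add: nexp_primitive_tensor H)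
  finally show "series_at nexp (series_coaddition ?H) = series_at nexp (primitive_tensor ?H)" .
qed

lemma pcoeff_umag_eval:
  assumes "\<And>x w. pcoeff (g x) w = scoeff (h x) w"
  shows "pcoeff (umag_eval g m) w = (scoeff (umag_eval h m) w :: 'k::comm_ring_1)"
proof -
  have "pcoeff (mag_eval g u) w = scoeff (mag_eval h u) w" for u w
    by (induction u arbitrary: w) (simp_all add: assms pcoeff_mult scoeff_mult)
  then show ?thesis by (cases m) (simp_all add: one_malg_def scoeff_one)
qed

lemma pcoeff_hom_component: "pcoeff (hom_component n f) m = (if deg m = n then scoeff f m else 0)"
  by transfer simp

text \<open>Taking homogeneous components commutes with the co-addition, since the co-addition of a word is
  homogeneous of the same degree. This carries the result from series over to $K\{X\}$.\<close>

lemma coaddition_hom_component: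
  fixes f :: "('x::finite umag, 'k::comm_ring_1) series"
  shows "pcoeff (coaddition (hom_component n f)) w = (if mdeg w = n then scoeff (series_coaddition f) w else 0)"
proof -
  let ?\<Delta> = "umag_eval (\<lambda>x. malg_var x \<otimes> 1 + 1 \<otimes> malg_var x)"
  let ?\<Delta>s = "umag_eval (\<lambda>x. primitive_tensor (series_var x))"
  let ?S = "{m :: 'x umag. deg m \<le> max n (mdeg w)}"
  have "pcoeff (malg_var x \<otimes> 1 + 1 \<otimes> malg_var x) p = (scoeff (primitive_tensor (series_var x)) p :: 'k)"
    for x :: 'x and p
    by (cases p) (simp add: primitive_tensor_def malg_var_def series_var_def one_malg_def one_series_def)
  then have \<Delta>: "pcoeff (?\<Delta> m) w = (scoeff (?\<Delta>s m) w :: 'k)" for m :: "'x umag"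
    by (rule pcoeff_umag_eval)
  have "pcoeff (coaddition (hom_component n f)) w = (\<Sum>m\<in>?S. pcoeff (hom_component n f) m * scoeff (?\<Delta>s m) w)"
    by (subst coaddition_superset [of ?S])
      (auto simp: finite_deg pcoeff_hom_component pcoeff_sum \<Delta>)
  also have "\<dots> = (\<Sum>m\<in>?S. if mdeg w = n then scoeff f m * scoeff (?\<Delta>s m) w else 0)"
    by (rule sum.cong) (auto simp: pcoeff_hom_component coaddition_homogeneous)
  also have "\<dots> = (if mdeg w = n then scoeff (series_coaddition f) w else 0)"
    unfolding series_coaddition_def
    by (simp add: scoeff_lin_ext_graded [OF series_rep_degree_raising [OF series_rep_coaddition], of w "max n (mdeg w)"] mdeg_umag_def)
  finally show ?thesis .
qed

theorem theorem6p1: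
  fixes n :: nat
  assumes "n \<ge> 1"
  shows "coaddition (hom_component n (hausdorff :: (xy umag, 'k::field_char_0) series))
       = hom_component n hausdorff \<otimes> 1 + 1 \<otimes> hom_component n hausdorff"
proof (rule malg_eqI)
  fix w :: "xy umag \<times> xy umag"
  obtain a b where w: "w = (a, b)" by (cases w)
  have d1: "deg (1 :: xy umag) = 0" by (simp add: one_umag_def)
  show "pcoeff (coaddition (hom_component n (hausdorff :: (xy umag, 'k) series))) w =
      pcoeff (hom_component n hausdorff \<otimes> 1 + 1 \<otimes> hom_component n hausdorff) w"
    unfolding coaddition_hom_component series_coaddition_hausdorff
    using assms d1
    by (auto simp: w d1 primitive_tensor_def pcoeff_hom_component one_malg_def scoeff_one
      mdeg_prod_def mdeg_umag_def deg_eq_0)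
qed

end
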